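(* Let $k$ be a field. For each of the following rings $R$, the injective dimension of $R$ as a module over itself is infinite: (1) $R=k[x_1,x_2,x_3]/(x_1x_2,x_1x_3)$; (2) $R=k[x_1,x_2]/(x_1^2,x_1x_2,x_2^2)$; (3) $R=k[x_1,\ldots,x_n]/I$ with $n\ge 2$ an integer and $I$ the ideal generated by $x_1^2$ and all products $x_ix_j$ with $1\le i\neq j\le n$. *)

theory Defs
  imports "HOL-Library.Poly_Mapping" "HOL-Library.Extended_Nat" "HOL-Algebra.QuotRing" "HOL-Algebra.Module"
begin

text \<open>
  Polynomials over a field \<^typ>\<open>'k\<close> are finitely supported maps from exponent vectors
  \<^typ>\<open>nat \<Rightarrow>\<^sub>0 nat\<close> to \<^typ>\<open>'k\<close>; \<open>mpoly_ring k n\<close> is the ring of those polynomials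
  in which only the variables with index in \<^term>\<open>{1..n}\<close> occur.
\<close>

type_synonym 'k mpoly = "(nat \<Rightarrow>\<^sub>0 nat) \<Rightarrow>\<^sub>0 'k"

definition mpoly_ring :: "'k::field itself \<Rightarrow> nat \<Rightarrow> 'k mpoly ring" where
  "mpoly_ring k n =
     \<lparr>carrier = {p. \<forall>m \<in> Poly_Mapping.keys p. Poly_Mapping.keys m \<subseteq> {1..n}},
      mult = (*), one = 1, zero = 0, add = (+)\<rparr>"

definition mpoly_var :: "nat \<Rightarrow> 'k::field mpoly" where
  "mpoly_var i = Poly_Mapping.single (Poly_Mapping.single i 1) 1"

definition regular_module :: "('r, 's) ring_scheme \<Rightarrow> ('r, 'r) module" where
  "regular_module R =
     \<lparr>carrier = carrier R, mult = mult R, one = one R, zero = zero R, add = add R,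
      smult = mult R\<rparr>"

definition module_hom ::
  "('r, 's) ring_scheme \<Rightarrow> ('r, 'a, 't) module_scheme \<Rightarrow> ('r, 'b, 'u) module_scheme \<Rightarrow> ('a \<Rightarrow> 'b) set"
where
  "module_hom R M N = {h \<in> carrier M \<rightarrow> carrier N.
     (\<forall>x \<in> carrier M. \<forall>y \<in> carrier M. h (x \<oplus>\<^bsub>M\<^esub> y) = h x \<oplus>\<^bsub>N\<^esub> h y) \<and>
     (\<forall>r \<in> carrier R. \<forall>x \<in> carrier M. h (r \<odot>\<^bsub>M\<^esub> x) = r \<odot>\<^bsub>N\<^esub> h x)}"

text \<open>
  A quantifier inside a definition cannot range over all types, so the lifting property is
  required for test modules whose elements are drawn from the type \<^typ>\<open>'r + 'm\<close>.
  By Baer's criterion this is no restriction: the inclusions of ideals into the ring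
  occur among these test maps. See \<open>injective_module_lift\<close> below, which
  recovers the lifting property for test modules of arbitrary type.
\<close>

definition injective_module :: "('r, 's) ring_scheme \<Rightarrow> ('r, 'm) module \<Rightarrow> bool" where
  "injective_module R E \<longleftrightarrow> module R E \<and>
     (\<forall>(A :: ('r, 'r + 'm) module) (B :: ('r, 'r + 'm) module) i f.
        module R A \<and> module R B \<and> i \<in> module_hom R A B \<and> inj_on i (carrier A) \<and>
        f \<in> module_hom R A E \<longrightarrow>
        (\<exists>g \<in> module_hom R B E. \<forall>x \<in> carrier A. g (i x) = f x))"

text \<open>\<open>0 \<rightarrow> M \<rightarrow> E 0 \<rightarrow> E 1 \<rightarrow> \<dots>\<close>, with augmentation \<open>e\<close> and differentials \<open>d\<close>.\<close>

definition injective_resolution ::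
  "('r, 's) ring_scheme \<Rightarrow> ('r, 'a) module \<Rightarrow> (nat \<Rightarrow> ('r, 'm) module) \<Rightarrow>
     ('a \<Rightarrow> 'm) \<Rightarrow> (nat \<Rightarrow> 'm \<Rightarrow> 'm) \<Rightarrow> bool"
where
  "injective_resolution R M E e d \<longleftrightarrow>
     (\<forall>i. injective_module R (E i)) \<and>
     e \<in> module_hom R M (E 0) \<and>
     (\<forall>i. d i \<in> module_hom R (E i) (E (Suc i))) \<and>
     inj_on e (carrier M) \<and>
     e ` carrier M = a_kernel (E 0) (E 1) (d 0) \<and>
     (\<forall>i. d i ` carrier (E i) = a_kernel (E (Suc i)) (E (Suc (Suc i))) (d (Suc i)))"

text \<open>
  The infimum of the lengths of the injective resolutions whose terms have elements of type
  \<^typ>\<open>'m\<close>; it is \<open>\<infinity>\<close> if there is no finite one. As with injectivity, the terms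
  cannot range over all types within the definition; a statement about every injective
  resolution has to leave \<^typ>\<open>'m\<close> arbitrary.
\<close>

definition injective_dimension ::
  "'m itself \<Rightarrow> ('r, 's) ring_scheme \<Rightarrow> ('r, 'a) module \<Rightarrow> enat"
where
  "injective_dimension (_ :: 'm itself) R M =
     Inf {enat n | n. \<exists>(E :: nat \<Rightarrow> ('r, 'm) module) e d.
        injective_resolution R M E e d \<and> (\<forall>i > n. carrier (E i) = {\<zero>\<^bsub>E i\<^esub>})}"

lemma cring_mpoly_ring: "cring (mpoly_ring k n)"
proof (rule cringI)
  show "abelian_group (mpoly_ring k n)"
  proof (rule abelian_groupI)
    fix x y assume "x \<in> carrier (mpoly_ring k n)" "y \<in> carrier (mpoly_ring k n)"
    then show "x \<oplus>\<^bsub>mpoly_ring k n\<^esub> y \<in> carrier (mpoly_ring k n)"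
      using Poly_Mapping.keys_add[of x y] unfolding mpoly_ring_def by auto
  next
    fix x assume x: "x \<in> carrier (mpoly_ring k n)"
    show "\<exists>y\<in>carrier (mpoly_ring k n). y \<oplus>\<^bsub>mpoly_ring k n\<^esub> x = \<zero>\<^bsub>mpoly_ring k n\<^esub>"
      using x by (intro bexI[of _ "- x"]) (auto simp: mpoly_ring_def)
  qed (auto simp: mpoly_ring_def add_ac)
  show "comm_monoid (mpoly_ring k n)"
  proof (rule comm_monoidI)
    fix x y assume xy: "x \<in> carrier (mpoly_ring k n)" "y \<in> carrier (mpoly_ring k n)"
    have "Poly_Mapping.keys (a + b) \<subseteq> {1..n}"
      if "a \<in> Poly_Mapping.keys x" "b \<in> Poly_Mapping.keys y" for a b
      using that xy Poly_Mapping.keys_add[of a b] unfolding mpoly_ring_def by fastforce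
    then show "x \<otimes>\<^bsub>mpoly_ring k n\<^esub> y \<in> carrier (mpoly_ring k n)"
      using Poly_Mapping.keys_mult[of x y] unfolding mpoly_ring_def by fastforce
  qed (auto simp: mpoly_ring_def mult_ac)
qed (auto simp: mpoly_ring_def algebra_simps)

lemma mpoly_var_in_carrier: "i \<in> {1..n} \<Longrightarrow> mpoly_var i \<in> carrier (mpoly_ring k n)"
  by (auto simp: mpoly_ring_def mpoly_var_def)

lemma module_regular_module:
  fixes R (structure)
  assumes "cring R" shows "module R (regular_module R)"
proof -
  interpret cring R by fact
  have "abelian_group (regular_module R)"
    by (rule abelian_groupI)
       (auto simp: regular_module_def a_ac intro!: bexI[of _ "\<ominus> _"] l_neg)
  then show ?thesis
    using \<open>cring R\<close>
    by (intro moduleI) (auto simp: regular_module_def l_distr r_distr m_assoc)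
qed

definition ideal_module :: "('r, 's) ring_scheme \<Rightarrow> 'r set \<Rightarrow> ('r, 'r + 'm) module" where
  "ideal_module R J =
     \<lparr>carrier = Inl ` J, mult = \<lambda>x y. x, one = Inl \<one>\<^bsub>R\<^esub>, zero = Inl \<zero>\<^bsub>R\<^esub>,
      add = \<lambda>x y. Inl (projl x \<oplus>\<^bsub>R\<^esub> projl y), smult = \<lambda>r x. Inl (r \<otimes>\<^bsub>R\<^esub> projl x)\<rparr>"

lemma module_ideal_module:
  fixes R :: "('r, 's) ring_scheme" (structure)
  assumes "cring R" "ideal J R" shows "module R (ideal_module R J :: ('r, 'r + 'm) module)"
proof -
  interpret cring R by fact
  interpret ideal J R by fact
  have c: "x \<in> carrier R" if "x \<in> J" for x using that by (rule a_Hcarr)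
  have "abelian_group (ideal_module R J :: ('r, 'r + 'm) module)"
  proof (rule abelian_groupI)
    fix x :: "'r + 'm" assume "x \<in> carrier (ideal_module R J)"
    then obtain j where j: "x = Inl j" "j \<in> J" by (auto simp: ideal_module_def)
    show "\<exists>y\<in>carrier (ideal_module R J). y \<oplus>\<^bsub>ideal_module R J\<^esub> x = \<zero>\<^bsub>ideal_module R J\<^esub>"
      using j c by (intro bexI[of _ "Inl (\<ominus> j)"]) (auto simp: ideal_module_def l_neg)
  qed (auto simp: ideal_module_def c a_ac)
  then show ?thesis
    using \<open>cring R\<close>
    by (intro moduleI) (auto simp: ideal_module_def l_distr r_distr m_assoc c I_l_closed)
qed

lemma injective_module_ideal:
  fixes R :: "('r, 's) ring_scheme" (structure) and E :: "('r, 'm) module"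
  assumes inj: "injective_module R E" and J: "ideal J R" and phi: "\<phi> \<in> J \<rightarrow> carrier E"
    and add: "\<And>x y. x \<in> J \<Longrightarrow> y \<in> J \<Longrightarrow> \<phi> (x \<oplus> y) = \<phi> x \<oplus>\<^bsub>E\<^esub> \<phi> y"
    and smult: "\<And>r x. r \<in> carrier R \<Longrightarrow> x \<in> J \<Longrightarrow> \<phi> (r \<otimes> x) = r \<odot>\<^bsub>E\<^esub> \<phi> x"
  obtains e where "e \<in> carrier E" "\<And>j. j \<in> J \<Longrightarrow> \<phi> j = j \<odot>\<^bsub>E\<^esub> e"
proof -
  interpret E: module R E using inj by (simp add: injective_module_def)
  interpret ideal J R by fact
  have R: "cring R" by (rule E.is_cring)
  define A B :: "('r, 'r + 'm) module"
    where "A = ideal_module R J" and "B = ideal_module R (carrier R)"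
  have c: "x \<in> carrier R" if "x \<in> J" for x using that by (rule a_Hcarr)
  have "module R A" "module R B"
    unfolding A_def B_def using R J E.R.oneideal by (auto intro: module_ideal_module)
  moreover have "id \<in> module_hom R A B" "inj_on id (carrier A)"
    by (auto simp: module_hom_def A_def B_def ideal_module_def c)
  moreover have "\<phi> \<circ> projl \<in> module_hom R A E"
    using phi by (auto simp: module_hom_def A_def ideal_module_def add smult)
  ultimately obtain g where g: "g \<in> module_hom R B E" "\<forall>x\<in>carrier A. g (id x) = (\<phi> \<circ> projl) x"
    using inj unfolding injective_module_def by blast
  show thesis
  proof
    show "g (Inl \<one>) \<in> carrier E"
      using g(1) by (auto simp: module_hom_def B_def ideal_module_def)
    fix j assume j: "j \<in> J"
    have "\<forall>r\<in>carrier R. \<forall>x\<in>carrier R. g (Inl (r \<otimes> x)) = r \<odot>\<^bsub>E\<^esub> g (Inl x)"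
      using g(1) by (auto simp: module_hom_def B_def ideal_module_def)
    then have "g (Inl (j \<otimes> \<one>)) = j \<odot>\<^bsub>E\<^esub> g (Inl \<one>)"
      using c[OF j] by blast
    then show "\<phi> j = j \<odot>\<^bsub>E\<^esub> g (Inl \<one>)"
      using g(2) j c[OF j] by (auto simp: A_def B_def ideal_module_def)
  qed
qed

theorem injective_module_lift:
  fixes A :: "('r, 'a) module" and B :: "('r, 'b) module" and E :: "('r, 'm) module"
    and R :: "('r, 's) ring_scheme" (structure)
  assumes inj: "injective_module R E" and A: "module R A" and B: "module R B"
    and i: "i \<in> module_hom R A B" "inj_on i (carrier A)" and f: "f \<in> module_hom R A E"
  shows "\<exists>g \<in> module_hom R B E. \<forall>x \<in> carrier A. g (i x) = f x"
proof -
  interpret E: module R E using inj by (simp add: injective_module_def)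
  interpret A: module R A by fact
  interpret B: module R B by fact
  have ic: "\<And>x. x \<in> carrier A \<Longrightarrow> i x \<in> carrier B"
    and iadd: "\<And>x y. x \<in> carrier A \<Longrightarrow> y \<in> carrier A \<Longrightarrow> i (x \<oplus>\<^bsub>A\<^esub> y) = i x \<oplus>\<^bsub>B\<^esub> i y"
    and ism: "\<And>r x. r \<in> carrier R \<Longrightarrow> x \<in> carrier A \<Longrightarrow> i (r \<odot>\<^bsub>A\<^esub> x) = r \<odot>\<^bsub>B\<^esub> i x"
    using i(1) by (auto simp: module_hom_def)
  have fc: "\<And>x. x \<in> carrier A \<Longrightarrow> f x \<in> carrier E"
    and fadd: "\<And>x y. x \<in> carrier A \<Longrightarrow> y \<in> carrier A \<Longrightarrow> f (x \<oplus>\<^bsub>A\<^esub> y) = f x \<oplus>\<^bsub>E\<^esub> f y"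
    and fsm: "\<And>r x. r \<in> carrier R \<Longrightarrow> x \<in> carrier A \<Longrightarrow> f (r \<odot>\<^bsub>A\<^esub> x) = r \<odot>\<^bsub>E\<^esub> f x"
    using f by (auto simp: module_hom_def)
  have i0: "i \<zero>\<^bsub>A\<^esub> = \<zero>\<^bsub>B\<^esub>"
    using ism[of \<zero> "\<zero>\<^bsub>A\<^esub>"] ic by (simp add: A.smult_l_null B.smult_l_null)
  have f0: "f \<zero>\<^bsub>A\<^esub> = \<zero>\<^bsub>E\<^esub>"
    using fsm[of \<zero> "\<zero>\<^bsub>A\<^esub>"] fc by (simp add: A.smult_l_null E.smult_l_null)
  define base where "base = (\<lambda>x. (i x, f x)) ` carrier A"
  define good where "good = {G. base \<subseteq> G \<and> G \<subseteq> carrier B \<times> carrier E \<and>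
    (\<forall>x y x' y'. (x, y) \<in> G \<longrightarrow> (x', y') \<in> G \<longrightarrow> (x \<oplus>\<^bsub>B\<^esub> x', y \<oplus>\<^bsub>E\<^esub> y') \<in> G) \<and>
    (\<forall>r x y. r \<in> carrier R \<longrightarrow> (x, y) \<in> G \<longrightarrow> (r \<odot>\<^bsub>B\<^esub> x, r \<odot>\<^bsub>E\<^esub> y) \<in> G) \<and>
    (\<forall>y. (\<zero>\<^bsub>B\<^esub>, y) \<in> G \<longrightarrow> y = \<zero>\<^bsub>E\<^esub>)}"
  have "base \<in> good"
  proof -
    have "f x = \<zero>\<^bsub>E\<^esub>" if "x \<in> carrier A" "i x = \<zero>\<^bsub>B\<^esub>" for x
    proof -
      have "x = \<zero>\<^bsub>A\<^esub>" using that i(2) i0 by (metis A.zero_closed inj_onD)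
      then show ?thesis using f0 by simp
    qed
    moreover have "(i x \<oplus>\<^bsub>B\<^esub> i x', f x \<oplus>\<^bsub>E\<^esub> f x') \<in> base"
      if "x \<in> carrier A" "x' \<in> carrier A" for x x'
      unfolding base_def using that
      by (intro image_eqI[of _ _ "x \<oplus>\<^bsub>A\<^esub> x'"]) (auto simp: iadd fadd)
    moreover have "(r \<odot>\<^bsub>B\<^esub> i x, r \<odot>\<^bsub>E\<^esub> f x) \<in> base"
      if "r \<in> carrier R" "x \<in> carrier A" for r x
      unfolding base_def using that
      by (intro image_eqI[of _ _ "r \<odot>\<^bsub>A\<^esub> x"]) (auto simp: ism fsm)
    ultimately show ?thesis
      unfolding good_def using ic fc by (auto simp: base_def)
  qed
  moreover have "\<Union>C \<in> good" if "C \<noteq> {}" "subset.chain good C" for C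
  proof -
    have sub: "C \<subseteq> good" and tot: "\<And>G H. G \<in> C \<Longrightarrow> H \<in> C \<Longrightarrow> G \<subseteq> H \<or> H \<subseteq> G"
      using that(2) by (auto simp: subset.chain_def)
    have "(x \<oplus>\<^bsub>B\<^esub> x', y \<oplus>\<^bsub>E\<^esub> y') \<in> \<Union>C" if xy: "(x, y) \<in> \<Union>C" "(x', y') \<in> \<Union>C" for x y x' y'
    proof -
      obtain G H where "G \<in> C" "H \<in> C" "(x, y) \<in> G" "(x', y') \<in> H" using xy by auto
      then obtain K where K: "K \<in> C" "(x, y) \<in> K" "(x', y') \<in> K" using tot by blast
      then show ?thesis using sub unfolding good_def by blast
    qed
    moreover have "base \<subseteq> \<Union>C" using that(1) sub unfolding good_def by blast
    moreover have "\<Union>C \<subseteq> carrier B \<times> carrier E" using sub unfolding good_def by blast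
    moreover have "(r \<odot>\<^bsub>B\<^esub> x, r \<odot>\<^bsub>E\<^esub> y) \<in> \<Union>C" if "r \<in> carrier R" "(x, y) \<in> \<Union>C" for r x y
      using sub that unfolding good_def by blast
    moreover have "y = \<zero>\<^bsub>E\<^esub>" if "(\<zero>\<^bsub>B\<^esub>, y) \<in> \<Union>C" for y
      using sub that unfolding good_def by blast
    ultimately show ?thesis unfolding good_def by blast
  qed
  ultimately obtain G where G: "G \<in> good" and max: "\<And>H. H \<in> good \<Longrightarrow> G \<subseteq> H \<Longrightarrow> H = G"
    using subset_Zorn_nonempty[of good] by (metis empty_iff)
  have Gbase: "base \<subseteq> G"
    and Gc: "\<And>x y. (x, y) \<in> G \<Longrightarrow> x \<in> carrier B" "\<And>x y. (x, y) \<in> G \<Longrightarrow> y \<in> carrier E"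
    and Gadd: "\<And>x y x' y'. (x, y) \<in> G \<Longrightarrow> (x', y') \<in> G \<Longrightarrow> (x \<oplus>\<^bsub>B\<^esub> x', y \<oplus>\<^bsub>E\<^esub> y') \<in> G"
    and Gsm: "\<And>r x y. r \<in> carrier R \<Longrightarrow> (x, y) \<in> G \<Longrightarrow> (r \<odot>\<^bsub>B\<^esub> x, r \<odot>\<^bsub>E\<^esub> y) \<in> G"
    and G0: "\<And>y. (\<zero>\<^bsub>B\<^esub>, y) \<in> G \<Longrightarrow> y = \<zero>\<^bsub>E\<^esub>"
    using G unfolding good_def by auto
  have Gz: "(\<zero>\<^bsub>B\<^esub>, \<zero>\<^bsub>E\<^esub>) \<in> G"
    using Gbase i0 f0 unfolding base_def by force
  have Gneg: "(\<ominus>\<^bsub>B\<^esub> x, \<ominus>\<^bsub>E\<^esub> y) \<in> G" if "(x, y) \<in> G" for x y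
    using Gsm[OF _ that, of "\<ominus> \<one>"] Gc[OF that] by (simp add: B.smult_l_minus E.smult_l_minus)
  have Guniq: "y = y'" if "(x, y) \<in> G" "(x, y') \<in> G" for x y y'
  proof -
    have "(x \<oplus>\<^bsub>B\<^esub> \<ominus>\<^bsub>B\<^esub> x, y \<oplus>\<^bsub>E\<^esub> \<ominus>\<^bsub>E\<^esub> y') \<in> G" using Gadd Gneg that by blast
    then have "y \<oplus>\<^bsub>E\<^esub> \<ominus>\<^bsub>E\<^esub> y' = \<zero>\<^bsub>E\<^esub>" using G0 Gc[OF that(1)] by (simp add: B.M.r_neg)
    then show ?thesis
      using Gc(2)[OF that(1)] Gc(2)[OF that(2)] by (metis E.M.add.inv_closed E.M.add.inv_inv E.M.minus_equality E.M.r_neg E.M.minus_unique)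
  qed
  have tot: "\<exists>y. (b, y) \<in> G" if b: "b \<in> carrier B" for b
  proof -
    define J where "J = {r \<in> carrier R. \<exists>y. (r \<odot>\<^bsub>B\<^esub> b, y) \<in> G}"
    define \<phi> where "\<phi> r = (SOME y. (r \<odot>\<^bsub>B\<^esub> b, y) \<in> G)" for r
    have phi: "(r \<odot>\<^bsub>B\<^esub> b, \<phi> r) \<in> G" if "r \<in> J" for r
      using that unfolding J_def \<phi>_def by (auto intro: someI)
    have phi_eq: "\<phi> r = y" if "(r \<odot>\<^bsub>B\<^esub> b, y) \<in> G" "r \<in> carrier R" for r y
      using phi[of r] that Guniq unfolding J_def by blast
    have Jadd: "((r \<oplus> s) \<odot>\<^bsub>B\<^esub> b, \<phi> r \<oplus>\<^bsub>E\<^esub> \<phi> s) \<in> G" if "r \<in> J" "s \<in> J" for r s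
      using Gadd[OF phi[OF that(1)] phi[OF that(2)]] that b
      by (auto simp: J_def B.smult_l_distr)
    have Jsm: "((r \<otimes> s) \<odot>\<^bsub>B\<^esub> b, r \<odot>\<^bsub>E\<^esub> \<phi> s) \<in> G" if "r \<in> carrier R" "s \<in> J" for r s
      using Gsm[OF that(1) phi[OF that(2)]] that b by (auto simp: J_def B.smult_assoc1)
    have "ideal J R"
    proof (rule idealI)
      show "ring R" by (rule E.R.ring_axioms)
      show "subgroup J (add_monoid R)"
      proof (rule E.R.add.subgroupI)
        show "J \<subseteq> carrier R" by (auto simp: J_def)
        show "J \<noteq> {}" using Gz b by (auto simp: J_def intro!: exI[of _ \<zero>])
        fix r assume r: "r \<in> J"
        then have "r \<in> carrier R" by (simp add: J_def)
        then show "\<ominus> r \<in> J"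
          using Gneg[OF phi[OF r]] b by (auto simp: J_def B.smult_l_minus)
      next
        fix r s assume "r \<in> J" "s \<in> J"
        then show "r \<oplus> s \<in> J" using Jadd[of r s] by (auto simp: J_def)
      qed
      fix s r assume "s \<in> J" "r \<in> carrier R"
      then show "r \<otimes> s \<in> J" using Jsm[of r s] by (auto simp: J_def)
      then show "s \<otimes> r \<in> J"
        using \<open>s \<in> J\<close> \<open>r \<in> carrier R\<close> by (simp add: J_def E.R.m_comm)
    qed
    moreover have "\<phi> \<in> J \<rightarrow> carrier E" using phi Gc by blast
    moreover have "\<phi> (r \<oplus> s) = \<phi> r \<oplus>\<^bsub>E\<^esub> \<phi> s" if "r \<in> J" "s \<in> J" for r s
      using Jadd[OF that] that by (intro phi_eq) (auto simp: J_def)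
    moreover have "\<phi> (r \<otimes> s) = r \<odot>\<^bsub>E\<^esub> \<phi> s" if "r \<in> carrier R" "s \<in> J" for r s
      using Jsm[OF that] that by (intro phi_eq) (auto simp: J_def)
    ultimately obtain e where e: "e \<in> carrier E" "\<And>j. j \<in> J \<Longrightarrow> \<phi> j = j \<odot>\<^bsub>E\<^esub> e"
      using injective_module_ideal[OF inj] by metis
    define H where
      "H = {(x \<oplus>\<^bsub>B\<^esub> r \<odot>\<^bsub>B\<^esub> b, y \<oplus>\<^bsub>E\<^esub> r \<odot>\<^bsub>E\<^esub> e) | x y r. (x, y) \<in> G \<and> r \<in> carrier R}"
    have HI: "(x \<oplus>\<^bsub>B\<^esub> r \<odot>\<^bsub>B\<^esub> b, y \<oplus>\<^bsub>E\<^esub> r \<odot>\<^bsub>E\<^esub> e) \<in> H" if "(x, y) \<in> G" "r \<in> carrier R" for x y r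
      using that unfolding H_def by blast
    have GH: "G \<subseteq> H"
    proof
      fix p assume p: "p \<in> G"
      obtain x y where xy: "p = (x, y)" by (cases p)
      show "p \<in> H" using HI[of x y \<zero>] p Gc[of x y] b e(1) unfolding xy by simp
    qed
    have "H \<in> good"
      unfolding good_def
    proof (intro CollectI conjI allI impI)
      show "base \<subseteq> H" using Gbase GH by blast
      show "H \<subseteq> carrier B \<times> carrier E" using Gc b e(1) by (auto simp: H_def)
    next
      fix x y x' y' assume "(x, y) \<in> H" "(x', y') \<in> H"
      then obtain u v r u' v' r' where *: "(u, v) \<in> G" "r \<in> carrier R" "(u', v') \<in> G" "r' \<in> carrier R"
        "x = u \<oplus>\<^bsub>B\<^esub> r \<odot>\<^bsub>B\<^esub> b" "y = v \<oplus>\<^bsub>E\<^esub> r \<odot>\<^bsub>E\<^esub> e" "x' = u' \<oplus>\<^bsub>B\<^esub> r' \<odot>\<^bsub>B\<^esub> b" "y' = v' \<oplus>\<^bsub>E\<^esub> r' \<odot>\<^bsub>E\<^esub> e"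
        unfolding H_def by blast
      have "x \<oplus>\<^bsub>B\<^esub> x' = (u \<oplus>\<^bsub>B\<^esub> u') \<oplus>\<^bsub>B\<^esub> (r \<oplus> r') \<odot>\<^bsub>B\<^esub> b"
        using * Gc b by (simp add: B.smult_l_distr B.M.a_ac)
      moreover have "y \<oplus>\<^bsub>E\<^esub> y' = (v \<oplus>\<^bsub>E\<^esub> v') \<oplus>\<^bsub>E\<^esub> (r \<oplus> r') \<odot>\<^bsub>E\<^esub> e"
        using * Gc e(1) by (simp add: E.smult_l_distr E.M.a_ac)
      ultimately show "(x \<oplus>\<^bsub>B\<^esub> x', y \<oplus>\<^bsub>E\<^esub> y') \<in> H"
        using HI[OF Gadd[OF *(1,3)], of "r \<oplus> r'"] * by simp
    next
      fix s x y assume s: "s \<in> carrier R" and "(x, y) \<in> H"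
      then obtain u v r where *: "(u, v) \<in> G" "r \<in> carrier R"
        "x = u \<oplus>\<^bsub>B\<^esub> r \<odot>\<^bsub>B\<^esub> b" "y = v \<oplus>\<^bsub>E\<^esub> r \<odot>\<^bsub>E\<^esub> e"
        unfolding H_def by blast
      show "(s \<odot>\<^bsub>B\<^esub> x, s \<odot>\<^bsub>E\<^esub> y) \<in> H"
        using HI[OF Gsm[OF s *(1)], of "s \<otimes> r"] * s b e(1) Gc[OF *(1)]
        by (simp add: B.smult_r_distr E.smult_r_distr B.smult_assoc1 E.smult_assoc1)
    next
      fix y assume "(\<zero>\<^bsub>B\<^esub>, y) \<in> H"
      then obtain u v r where *: "(u, v) \<in> G" "r \<in> carrier R"
        "\<zero>\<^bsub>B\<^esub> = u \<oplus>\<^bsub>B\<^esub> r \<odot>\<^bsub>B\<^esub> b" "y = v \<oplus>\<^bsub>E\<^esub> r \<odot>\<^bsub>E\<^esub> e"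
        unfolding H_def by blast
      have "r \<odot>\<^bsub>B\<^esub> b = \<ominus>\<^bsub>B\<^esub> u"
        using * b Gc(1)[OF *(1)] by (metis B.M.minus_equality B.smult_closed B.M.a_comm)
      then have rG: "(r \<odot>\<^bsub>B\<^esub> b, \<ominus>\<^bsub>E\<^esub> v) \<in> G" using Gneg[OF *(1)] by simp
      then have "r \<in> J" using *(2) by (auto simp: J_def)
      then have "r \<odot>\<^bsub>E\<^esub> e = \<ominus>\<^bsub>E\<^esub> v" using e(2) phi_eq[OF rG *(2)] by simp
      then show "y = \<zero>\<^bsub>E\<^esub>" using * Gc(2)[OF *(1)] by (simp add: E.M.r_neg)
    qed
    then have "H = G" using max GH by blast
    then show ?thesis using HI[OF Gz, of \<one>] b e(1) by auto
  qed
  define g where "g b = (SOME y. (b, y) \<in> G)" for b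
  have g: "(b, g b) \<in> G" if "b \<in> carrier B" for b
    using tot[OF that] unfolding g_def by (auto intro: someI)
  show ?thesis
  proof
    show "g \<in> module_hom R B E"
      unfolding module_hom_def
    proof (intro CollectI conjI ballI)
      show "g \<in> carrier B \<rightarrow> carrier E" using g Gc by blast
    next
      fix x y assume "x \<in> carrier B" "y \<in> carrier B"
      then show "g (x \<oplus>\<^bsub>B\<^esub> y) = g x \<oplus>\<^bsub>E\<^esub> g y"
        using g Gadd by (intro Guniq[of "x \<oplus>\<^bsub>B\<^esub> y"]) auto
    next
      fix r x assume "r \<in> carrier R" "x \<in> carrier B"
      then show "g (r \<odot>\<^bsub>B\<^esub> x) = r \<odot>\<^bsub>E\<^esub> g x"
        using g Gsm by (intro Guniq[of "r \<odot>\<^bsub>B\<^esub> x"]) auto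
    qed
    show "\<forall>x\<in>carrier A. g (i x) = f x"
      using g ic Gbase Guniq unfolding base_def by blast
  qed
qed

end

theory Submission
  imports Defs
begin

text \<open>
  In a finite injective resolution \<open>E\<close> of \<open>R\<close> the groups \<open>Ext\<^sup>i(R/(S), R)\<close> vanish for large \<open>i\<close>,
  for every ideal \<open>(S)\<close>. They are the cohomology groups of \<open>Hom(R/(S), E)\<close>, that is, of the
  subcomplex of the elements killed by \<open>S\<close>. So it suffices to find one \<open>S\<close> such that a nonzero class in some degree always gives a nonzero class in a higher
  degree, and a nonzero class to start from. Both are done by a chase of elements that uses
  injectivity only as solvability of equations (\<open>injective_module_solve\<close>): \<open>x e = a\<close>,
  \<open>J e = 0\<close> has a solution \<open>e\<close> as soon as \<open>(J : x)\<close> annihilates \<open>a\<close>. The rings are quotients by monomial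
  ideals, where the colon ideals \<open>(J : x)\<close> are read off from exponent vectors.

  For \<open>k[x\<^sub>1, x\<^sub>2]/(x\<^sub>1\<^sup>2, x\<^sub>1 x\<^sub>2, x\<^sub>2\<^sup>2)\<close> and for \<open>k[x\<^sub>1, \<dots>, x\<^sub>n]/(x\<^sub>1\<^sup>2, x\<^sub>i x\<^sub>j)\<close>
  with all \<open>i \<noteq> j\<close>, let \<open>S\<close> be the set of all the variables and \<open>\<mm>\<close> the ideal that they generate. The variable \<open>x\<^sub>1\<close> is killed by \<open>\<mm>\<close>, and \<open>\<mm> = R x\<^sub>1 \<oplus> (x\<^sub>2, \<dots>, x\<^sub>n)\<close>, so the residue field
  \<open>k = R/\<mm>\<close> is isomorphic to a direct summand of its own first syzygy \<open>\<mm>\<close>. Hence \<open>Ext\<^sup>i(k, R)\<close> embeds into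
  \<open>Ext\<^sup>i\<^sup>+\<^sup>1(k, R)\<close> for \<open>i \<ge> 1\<close>; and \<open>Ext\<^sup>1(k, R) \<noteq> 0\<close>, because the map \<open>\<mm> \<rightarrow> R\<close> that fixes \<open>x\<^sub>1\<close>
  and kills the other variables is not multiplication by an element of \<open>R\<close>.

  For \<open>k[x, y, z]/(x y, x z)\<close>, write \<open>A = R/(x)\<close> for the coordinate ring of the plane
  and \<open>B = R/(y, z)\<close> for that of the line. The syzygy of \<open>A\<close> is \<open>(x) \<cong> B\<close>, the syzygy of \<open>B\<close> is the
  ideal \<open>(y, z)\<close> of \<open>A\<close>, and the Koszul sequence \<open>0 \<rightarrow> A \<rightarrow> A\<^sup>2 \<rightarrow> (y, z) \<rightarrow> 0\<close> gives a connecting map.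
  Together they give \<open>Ext\<^sup>i(A, R) \<rightarrow> Ext\<^sup>i\<^sup>+\<^sup>1((y, z), R) \<rightarrow> Ext\<^sup>i\<^sup>+\<^sup>2(B, R) \<rightarrow> Ext\<^sup>i\<^sup>+\<^sup>3(A, R)\<close>, whose kernel
  consists of the classes \<open>y s + z t\<close>. For \<open>i \<ge> 1\<close> the elements \<open>y\<close> and \<open>z\<close> act as zero on \<open>Ext\<^sup>i(A, R)\<close>,
  so there the composite is injective. In degree \<open>0\<close>, \<open>Hom(A, R)\<close> is the ideal \<open>(y, z)\<close> of \<open>R\<close>, and \<open>y\<close>
  is not in \<open>(y, z)\<^sup>2\<close>, so \<open>y\<close> has a nonzero image in \<open>Ext\<^sup>3(A, R)\<close>.
\<close>

section \<open>Solving equations in an injective module\<close>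

text \<open>
  The assignment \<open>j + r x \<mapsto> r a\<close> is a well-defined homomorphism on the ideal \<open>J + R x\<close> precisely when
  \<open>r x \<in> J\<close> forces \<open>r a = 0\<close>, and an injective module turns it into multiplication of an element \<open>e\<close>.
\<close>

lemma injective_module_solve:
  fixes R :: "('r, 's) ring_scheme" (structure) and E :: "('r, 'm) module"
  assumes inj: "injective_module R E" and J: "ideal J R"
    and x: "x \<in> carrier R" and a: "a \<in> carrier E"
    and colon: "\<And>r. r \<in> carrier R \<Longrightarrow> r \<otimes> x \<in> J \<Longrightarrow> r \<odot>\<^bsub>E\<^esub> a = \<zero>\<^bsub>E\<^esub>"
  obtains e where "e \<in> carrier E" "x \<odot>\<^bsub>E\<^esub> e = a" "\<And>j. j \<in> J \<Longrightarrow> j \<odot>\<^bsub>E\<^esub> e = \<zero>\<^bsub>E\<^esub>"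
proof -
  interpret E: module R E using inj by (simp add: injective_module_def)
  interpret J: ideal J R by fact
  have Jc: "j \<in> carrier R" if "j \<in> J" for j using that by (rule J.a_Hcarr)
  define K where "K = {j \<oplus> r \<otimes> x | j r. j \<in> J \<and> r \<in> carrier R}"
  have KI: "j \<oplus> r \<otimes> x \<in> K" if "j \<in> J" "r \<in> carrier R" for j r
    using that unfolding K_def by blast
  define \<phi> where "\<phi> k = (THE b. \<exists>j\<in>J. \<exists>r\<in>carrier R. k = j \<oplus> r \<otimes> x \<and> b = r \<odot>\<^bsub>E\<^esub> a)" for k
  have uniq: "r \<odot>\<^bsub>E\<^esub> a = s \<odot>\<^bsub>E\<^esub> a"
    if eq: "j \<oplus> r \<otimes> x = i \<oplus> s \<otimes> x" and mem: "j \<in> J" "i \<in> J" "r \<in> carrier R" "s \<in> carrier R" for i j r s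
  proof -
    have "(r \<ominus> s) \<otimes> x = \<ominus> j \<oplus> (j \<oplus> r \<otimes> x) \<oplus> \<ominus> (s \<otimes> x)"
      using mem x Jc by (simp add: E.R.l_distr E.R.l_minus E.R.minus_eq E.R.r_neg1)
    also have "\<dots> = i \<ominus> j"
      unfolding eq using mem x Jc by (simp add: E.R.minus_eq E.R.a_ac E.R.r_neg)
    finally have "(r \<ominus> s) \<otimes> x \<in> J"
      using mem by (simp add: E.R.minus_eq)
    then have "(r \<ominus> s) \<odot>\<^bsub>E\<^esub> a = \<zero>\<^bsub>E\<^esub>" using colon mem by simp
    then have "r \<odot>\<^bsub>E\<^esub> a \<oplus>\<^bsub>E\<^esub> \<ominus>\<^bsub>E\<^esub> (s \<odot>\<^bsub>E\<^esub> a) = \<zero>\<^bsub>E\<^esub>"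
      using mem a by (simp add: E.R.minus_eq E.smult_l_distr E.smult_l_minus)
    then show ?thesis
      using mem a E.M.minus_equality[of "r \<odot>\<^bsub>E\<^esub> a" "\<ominus>\<^bsub>E\<^esub> (s \<odot>\<^bsub>E\<^esub> a)"] by simp
  qed
  have phi: "\<phi> (j \<oplus> r \<otimes> x) = r \<odot>\<^bsub>E\<^esub> a" if "j \<in> J" "r \<in> carrier R" for j r
    unfolding \<phi>_def
  proof (rule the_equality)
    show "\<exists>i\<in>J. \<exists>s\<in>carrier R. j \<oplus> r \<otimes> x = i \<oplus> s \<otimes> x \<and> r \<odot>\<^bsub>E\<^esub> a = s \<odot>\<^bsub>E\<^esub> a"
      using that by auto
    fix b assume "\<exists>i\<in>J. \<exists>s\<in>carrier R. j \<oplus> r \<otimes> x = i \<oplus> s \<otimes> x \<and> b = s \<odot>\<^bsub>E\<^esub> a"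
    then obtain i s where "i \<in> J" "s \<in> carrier R" "j \<oplus> r \<otimes> x = i \<oplus> s \<otimes> x" "b = s \<odot>\<^bsub>E\<^esub> a"
      by (elim bexE conjE)
    then show "b = r \<odot>\<^bsub>E\<^esub> a" using uniq[of j r i s] that by simp
  qed
  have add: "(j \<oplus> r \<otimes> x) \<oplus> (i \<oplus> s \<otimes> x) = (j \<oplus> i) \<oplus> (r \<oplus> s) \<otimes> x"
    if "j \<in> J" "i \<in> J" "r \<in> carrier R" "s \<in> carrier R" for i j r s
    using that x Jc by (simp add: E.R.l_distr E.R.a_ac)
  have mul: "s \<otimes> (j \<oplus> r \<otimes> x) = s \<otimes> j \<oplus> (s \<otimes> r) \<otimes> x"
    if "j \<in> J" "r \<in> carrier R" "s \<in> carrier R" for j r s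
    using that x Jc by (simp add: E.R.r_distr E.R.m_assoc)
  have K: "ideal K R"
  proof (rule idealI)
    show "ring R" by (rule E.R.ring_axioms)
    show "subgroup K (add_monoid R)"
    proof (rule E.R.add.subgroupI)
      show "K \<subseteq> carrier R" using Jc x by (auto simp: K_def)
      show "K \<noteq> {}" using KI[OF J.zero_closed E.R.zero_closed] by blast
      fix k assume "k \<in> K"
      then obtain j r where k: "k = j \<oplus> r \<otimes> x" "j \<in> J" "r \<in> carrier R" unfolding K_def by blast
      have "\<ominus> k = \<ominus> j \<oplus> (\<ominus> r) \<otimes> x" using k Jc x by (simp add: E.R.minus_add E.R.l_minus)
      then show "\<ominus> k \<in> K" using KI[of "\<ominus> j" "\<ominus> r"] k by simp
    next
      fix k l assume "k \<in> K" "l \<in> K"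
      then show "k \<oplus> l \<in> K" using add KI unfolding K_def by fastforce
    qed
    fix k s assume k: "k \<in> K" and s: "s \<in> carrier R"
    then obtain j r where jr: "k = j \<oplus> r \<otimes> x" "j \<in> J" "r \<in> carrier R" unfolding K_def by blast
    show 1: "s \<otimes> k \<in> K"
      using mul[of j r s] KI[of "s \<otimes> j" "s \<otimes> r"] jr s J.I_l_closed by simp
    have "k \<in> carrier R" using jr Jc x by simp
    then show "k \<otimes> s \<in> K" using 1 s by (simp add: E.R.m_comm)
  qed
  have "\<phi> \<in> K \<rightarrow> carrier E" using phi a unfolding K_def by auto
  moreover have "\<phi> (k \<oplus> l) = \<phi> k \<oplus>\<^bsub>E\<^esub> \<phi> l" if "k \<in> K" "l \<in> K" for k l
  proof -
    obtain j r i s where "k = j \<oplus> r \<otimes> x" "j \<in> J" "r \<in> carrier R"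
      "l = i \<oplus> s \<otimes> x" "i \<in> J" "s \<in> carrier R" using \<open>k \<in> K\<close> \<open>l \<in> K\<close> unfolding K_def by blast
    then show ?thesis
      using a by (simp add: add phi E.smult_l_distr)
  qed
  moreover have "\<phi> (s \<otimes> k) = s \<odot>\<^bsub>E\<^esub> \<phi> k" if "s \<in> carrier R" "k \<in> K" for s k
  proof -
    obtain j r where "k = j \<oplus> r \<otimes> x" "j \<in> J" "r \<in> carrier R"
      using \<open>k \<in> K\<close> unfolding K_def by blast
    then show ?thesis
      using \<open>s \<in> carrier R\<close> a by (simp add: mul phi J.I_l_closed E.smult_assoc1)
  qed
  ultimately obtain e where e: "e \<in> carrier E" "\<And>k. k \<in> K \<Longrightarrow> \<phi> k = k \<odot>\<^bsub>E\<^esub> e"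
    using injective_module_ideal[OF inj K] by metis
  show thesis
  proof (rule that[OF e(1)])
    show "x \<odot>\<^bsub>E\<^esub> e = a"
      using e(2)[OF KI[of \<zero> \<one>]] phi[of \<zero> \<one>] x a by simp
    fix j assume "j \<in> J"
    then show "j \<odot>\<^bsub>E\<^esub> e = \<zero>\<^bsub>E\<^esub>"
      using e(2)[OF KI[of j \<zero>]] phi[of j \<zero>] x a Jc by simp
  qed
qed

section \<open>Chasing cocycles through an acyclic complex\<close>

text \<open>
  An injective resolution without its augmentation. What injectivity contributes, namely that certain
  equations can be solved in each \<open>E i\<close>, appears below as assumptions of the individual chases.
\<close>

locale acyclic_module_complex = cring R for R :: "('r, 's) ring_scheme" (structure) +
  fixes E :: "nat \<Rightarrow> ('r, 'm, 't) module_scheme" and d :: "nat \<Rightarrow> 'm \<Rightarrow> 'm"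
  assumes module_E: "module R (E i)"
    and d_hom: "d i \<in> module_hom R (E i) (E (Suc i))"
    and d_exact: "d i ` carrier (E i) = a_kernel (E (Suc i)) (E (Suc (Suc i))) (d (Suc i))"
begin

text \<open>
  The elements of \<open>E i\<close> killed by \<open>S\<close> are the homomorphisms \<open>R/(S) \<rightarrow> E i\<close>.
\<close>

definition killed :: "'r set \<Rightarrow> nat \<Rightarrow> 'm set" where
  "killed S i = {a \<in> carrier (E i). \<forall>s\<in>S. s \<odot>\<^bsub>E i\<^esub> a = \<zero>\<^bsub>E i\<^esub>}"

definition cocycle :: "'r set \<Rightarrow> nat \<Rightarrow> 'm set" where
  "cocycle S i = {a \<in> killed S i. d i a = \<zero>\<^bsub>E (Suc i)\<^esub>}"

text \<open>
  For the complex of an injective resolution of \<open>M\<close> this says \<open>Ext\<^sup>i\<^sup>+\<^sup>1(R/(S), M) \<noteq> 0\<close>. The degree is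
  shifted by one because the coboundaries in degree \<open>0\<close> are not images under a differential.
\<close>

definition ext_Suc_nonzero :: "'r set \<Rightarrow> nat \<Rightarrow> bool" where
  "ext_Suc_nonzero S i \<longleftrightarrow> \<not> cocycle S (Suc i) \<subseteq> d i ` killed S i"

sublocale E: module R "E i" for i by (rule module_E)

lemma d_closed [simp, intro]: "a \<in> carrier (E i) \<Longrightarrow> d i a \<in> carrier (E (Suc i))"
  and d_add: "a \<in> carrier (E i) \<Longrightarrow> b \<in> carrier (E i) \<Longrightarrow> d i (a \<oplus>\<^bsub>E i\<^esub> b) = d i a \<oplus>\<^bsub>E (Suc i)\<^esub> d i b"
  and d_smult: "r \<in> carrier R \<Longrightarrow> a \<in> carrier (E i) \<Longrightarrow> d i (r \<odot>\<^bsub>E i\<^esub> a) = r \<odot>\<^bsub>E (Suc i)\<^esub> d i a"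
  using d_hom[of i] by (auto simp: module_hom_def)

lemma d_d [simp]: "a \<in> carrier (E i) \<Longrightarrow> d (Suc i) (d i a) = \<zero>\<^bsub>E (Suc (Suc i))\<^esub>"
  using d_exact[of i] unfolding a_kernel_def' by blast

lemma d_zero [simp]: "d i \<zero>\<^bsub>E i\<^esub> = \<zero>\<^bsub>E (Suc i)\<^esub>"
  using d_smult[of \<zero> "\<zero>\<^bsub>E i\<^esub>" i] by simp

lemma d_diff:
  assumes "a \<in> carrier (E i)" "b \<in> carrier (E i)"
  shows "d i (a \<ominus>\<^bsub>E i\<^esub> b) = d i a \<ominus>\<^bsub>E (Suc i)\<^esub> d i b"
proof -
  have m: "c \<ominus>\<^bsub>E j\<^esub> c' = c \<oplus>\<^bsub>E j\<^esub> (\<ominus> \<one>) \<odot>\<^bsub>E j\<^esub> c'"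
    if "c' \<in> carrier (E j)" for c c' j
    using that by (simp add: E.smult_l_minus E.minus_eq)
  show ?thesis
    using assms by (simp add: m d_add d_smult)
qed

lemma smult_diff:
  assumes "r \<in> carrier R" "a \<in> carrier (E i)" "b \<in> carrier (E i)"
  shows "r \<odot>\<^bsub>E i\<^esub> (a \<ominus>\<^bsub>E i\<^esub> b) = r \<odot>\<^bsub>E i\<^esub> a \<ominus>\<^bsub>E i\<^esub> r \<odot>\<^bsub>E i\<^esub> b"
  using assms by (simp add: E.minus_eq E.smult_r_distr E.smult_r_minus)

lemma diff_zero [simp]:
  assumes "a \<in> carrier (E i)" shows "a \<ominus>\<^bsub>E i\<^esub> \<zero>\<^bsub>E i\<^esub> = a"
proof -
  have "\<ominus>\<^bsub>E i\<^esub> \<zero>\<^bsub>E i\<^esub> = \<zero>\<^bsub>E i\<^esub>"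
    by (rule E.M.minus_equality) (rule E.M.l_zero, (rule E.M.zero_closed)+)
  then show ?thesis unfolding E.minus_eq by (simp only: E.M.r_zero assms)
qed

lemma diff_self [simp]: "a \<in> carrier (E i) \<Longrightarrow> a \<ominus>\<^bsub>E i\<^esub> a = \<zero>\<^bsub>E i\<^esub>"
  by (simp add: E.minus_eq E.r_neg)

lemma primitive:
  assumes "a \<in> carrier (E (Suc i))" "d (Suc i) a = \<zero>\<^bsub>E (Suc (Suc i))\<^esub>"
  obtains w where "w \<in> carrier (E i)" "d i w = a"
proof -
  have "a \<in> d i ` carrier (E i)" unfolding d_exact a_kernel_def' using assms by blast
  then show thesis using that by (elim imageE) simp
qed

lemma killedD: "a \<in> killed S i \<Longrightarrow> a \<in> carrier (E i)"
  "a \<in> killed S i \<Longrightarrow> s \<in> S \<Longrightarrow> s \<odot>\<^bsub>E i\<^esub> a = \<zero>\<^bsub>E i\<^esub>"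
  unfolding killed_def by blast+

lemma cocycleD: "a \<in> cocycle S i \<Longrightarrow> a \<in> killed S i"
  "a \<in> cocycle S i \<Longrightarrow> a \<in> carrier (E i)"
  "a \<in> cocycle S i \<Longrightarrow> s \<in> S \<Longrightarrow> s \<odot>\<^bsub>E i\<^esub> a = \<zero>\<^bsub>E i\<^esub>"
  "a \<in> cocycle S i \<Longrightarrow> d i a = \<zero>\<^bsub>E (Suc i)\<^esub>"
  unfolding cocycle_def killed_def by blast+

lemma ext_Suc_zero:
  assumes "carrier (E (Suc i)) = {\<zero>\<^bsub>E (Suc i)\<^esub>}" and "S \<subseteq> carrier R"
  shows "\<not> ext_Suc_nonzero S i"
proof -
  have "\<zero>\<^bsub>E i\<^esub> \<in> killed S i" using assms(2) by (auto simp: killed_def)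
  then have "\<zero>\<^bsub>E (Suc i)\<^esub> \<in> d i ` killed S i" by (metis d_zero imageI)
  moreover have "a = \<zero>\<^bsub>E (Suc i)\<^esub>" if "a \<in> cocycle S (Suc i)" for a
    using cocycleD(2)[OF that] unfolding assms(1) by (rule singletonD)
  ultimately have "cocycle S (Suc i) \<subseteq> d i ` killed S i" by (metis subsetI)
  then show ?thesis unfolding ext_Suc_nonzero_def by simp
qed

text \<open>
  Let \<open>\<mm>\<close> be generated by \<open>x\<close> and \<open>S\<close>. The lifting assumption is what injectivity gives when
  \<open>\<mm> = R x \<oplus> (S)\<close> with \<open>R x \<cong> R/\<mm>\<close>: a cocycle \<open>a\<close> killed by \<open>\<mm>\<close> is the homomorphism \<open>\<mm> \<rightarrow> E i\<close> with
  \<open>x \<mapsto> a\<close> and \<open>S \<mapsto> 0\<close>. If \<open>e\<close> extends it to \<open>R\<close>, then \<open>d e\<close> is its image under the connecting map,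
  and \<open>d e\<close> is a coboundary only if \<open>a\<close> is \<open>x\<close> times a cocycle killed by \<open>S\<close>.
\<close>

lemma residue_ext_from_cocycle:
  assumes x: "x \<in> carrier R" and S: "S \<subseteq> carrier R"
    and lift: "\<And>b j. b \<in> killed (insert x S) j \<Longrightarrow> \<exists>e \<in> killed S j. x \<odot>\<^bsub>E j\<^esub> e = b"
    and a: "a \<in> cocycle (insert x S) i"
    and nontriv: "\<And>r. r \<in> cocycle S i \<Longrightarrow> x \<odot>\<^bsub>E i\<^esub> r \<noteq> a"
  shows "ext_Suc_nonzero (insert x S) i"
proof -
  obtain e where e: "e \<in> killed S i" "x \<odot>\<^bsub>E i\<^esub> e = a"
    using lift cocycleD(1)[OF a] by blast
  note ec = killedD(1)[OF e(1)]
  have "t \<odot>\<^bsub>E (Suc i)\<^esub> d i e = \<zero>\<^bsub>E (Suc i)\<^esub>" if "t \<in> insert x S" for t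
    using that x S ec e(2) cocycleD(4)[OF a] killedD(2)[OF e(1)]
    by (metis d_smult d_zero insert_iff subsetD)
  then have "d i e \<in> cocycle (insert x S) (Suc i)"
    using ec by (simp add: cocycle_def killed_def)
  moreover have "d i e \<notin> d i ` killed (insert x S) i"
  proof
    assume "d i e \<in> d i ` killed (insert x S) i"
    then obtain g where g: "g \<in> killed (insert x S) i" "d i e = d i g" by blast
    note gc = killedD(1)[OF g(1)]
    have "e \<ominus>\<^bsub>E i\<^esub> g \<in> cocycle S i"
      using ec gc g(2) killedD(2)[OF e(1)] killedD(2)[OF g(1)] S
      by (auto simp: cocycle_def killed_def d_diff smult_diff subset_iff)
    moreover have "x \<odot>\<^bsub>E i\<^esub> (e \<ominus>\<^bsub>E i\<^esub> g) = a"
      using x ec gc e(2) killedD(2)[OF g(1), of x] cocycleD(2)[OF a] by (simp add: smult_diff)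
    ultimately show False using nontriv by blast
  qed
  ultimately show ?thesis unfolding ext_Suc_nonzero_def by blast
qed

text \<open>
  In positive degree a cocycle \<open>r\<close> is \<open>d h\<close> for some \<open>h\<close>, hence \<open>x r = d (x h)\<close>, where \<open>x h\<close> is killed
  by \<open>\<mm>\<close> because \<open>\<mm> x = 0\<close>. So a cocycle that is not a coboundary is not of the form
  \<open>x r\<close>, and the connecting map does not send it to a coboundary.
\<close>

lemma residue_ext_step:
  assumes x: "x \<in> carrier R" and S: "S \<subseteq> carrier R"
    and lift: "\<And>b j. b \<in> killed (insert x S) j \<Longrightarrow> \<exists>e \<in> killed S j. x \<odot>\<^bsub>E j\<^esub> e = b"
    and soc: "\<And>t. t \<in> insert x S \<Longrightarrow> t \<otimes> x = \<zero>"
    and nonzero: "ext_Suc_nonzero (insert x S) i"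
  shows "ext_Suc_nonzero (insert x S) (Suc i)"
proof -
  obtain a where a: "a \<in> cocycle (insert x S) (Suc i)" "a \<notin> d i ` killed (insert x S) i"
    using nonzero unfolding ext_Suc_nonzero_def by blast
  show ?thesis
  proof (rule residue_ext_from_cocycle[OF x S lift a(1)])
    fix r assume r: "r \<in> cocycle S (Suc i)"
    obtain h where h: "h \<in> carrier (E i)" "d i h = r"
      using primitive[OF cocycleD(2,4)[OF r]] .
    have "t \<odot>\<^bsub>E i\<^esub> (x \<odot>\<^bsub>E i\<^esub> h) = \<zero>\<^bsub>E i\<^esub>" if "t \<in> insert x S" for t
      using soc[OF that] that x S h(1) by (metis E.smult_assoc1 E.smult_l_null insert_iff subsetD)
    then have "x \<odot>\<^bsub>E i\<^esub> h \<in> killed (insert x S) i"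
      using x h(1) by (simp add: killed_def)
    moreover have "x \<odot>\<^bsub>E (Suc i)\<^esub> r = d i (x \<odot>\<^bsub>E i\<^esub> h)" using h x by (simp add: d_smult)
    ultimately show "x \<odot>\<^bsub>E (Suc i)\<^esub> r \<noteq> a" using a(2) by blast
  qed
qed

text \<open>
  The three connecting maps \<open>Ext\<^sup>i(A) \<rightarrow> Ext\<^sup>i\<^sup>+\<^sup>1((y, z)) \<rightarrow> Ext\<^sup>i\<^sup>+\<^sup>2(B) \<rightarrow> Ext\<^sup>i\<^sup>+\<^sup>3(A)\<close>, with \<open>A = R/(x)\<close> and
  \<open>B = R/(y, z)\<close>, on elements: \<open>a = y q\<close>, then \<open>d q = z e\<close> with \<open>y e = 0\<close>, then \<open>d e = x c\<close>, and the
  class of \<open>a\<close> goes to that of \<open>d c\<close>. A homomorphism \<open>(y, z) \<rightarrow> E j\<close> is a pair \<open>(u, v)\<close> of elements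
  killed by \<open>x\<close> with \<open>z u = y v\<close>; the one that occurs is \<open>(0, d q)\<close>.
\<close>

lemma plane_line_ext_from_cocycle:
  assumes R: "x \<in> carrier R" "y \<in> carrier R" "z \<in> carrier R"
    and xy: "x \<otimes> y = \<zero>" and xz: "x \<otimes> z = \<zero>"
    and lift_x: "\<And>b j. b \<in> killed {y, z} j \<Longrightarrow> \<exists>e \<in> carrier (E j). x \<odot>\<^bsub>E j\<^esub> e = b"
    and lift_y: "\<And>b j. b \<in> killed {x} j \<Longrightarrow> \<exists>e \<in> killed {x} j. y \<odot>\<^bsub>E j\<^esub> e = b"
    and lift_z: "\<And>b j. b \<in> killed {x, y} j \<Longrightarrow> \<exists>e \<in> killed {y} j. z \<odot>\<^bsub>E j\<^esub> e = b"
    and a: "a \<in> cocycle {x} i"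
    and nontriv: "\<And>s t. s \<in> cocycle {x} i \<Longrightarrow> t \<in> cocycle {x} i \<Longrightarrow>
      y \<odot>\<^bsub>E i\<^esub> s \<oplus>\<^bsub>E i\<^esub> z \<odot>\<^bsub>E i\<^esub> t \<noteq> a"
  shows "ext_Suc_nonzero {x} (Suc (Suc i))"
proof -
  let ?i1 = "Suc i" and ?i2 = "Suc (Suc i)" and ?i3 = "Suc (Suc (Suc i))"
  obtain q where q: "q \<in> killed {x} i" "y \<odot>\<^bsub>E i\<^esub> q = a"
    by (rule bexE[OF lift_y[OF cocycleD(1)[OF a]]])
  note qc = killedD(1)[OF q(1)] and xq = killedD(2)[OF q(1) singletonI]
  have v: "x \<odot>\<^bsub>E ?i1\<^esub> d i q = \<zero>\<^bsub>E ?i1\<^esub>" "y \<odot>\<^bsub>E ?i1\<^esub> d i q = \<zero>\<^bsub>E ?i1\<^esub>"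
    using d_smult[OF R(1) qc] d_smult[OF R(2) qc] xq q(2) cocycleD(4)[OF a] by simp_all
  then have "d i q \<in> killed {x, y} ?i1" using qc by (simp add: killed_def)
  from lift_z[OF this] obtain e where e: "e \<in> killed {y} ?i1" "z \<odot>\<^bsub>E ?i1\<^esub> e = d i q" by blast
  note ec = killedD(1)[OF e(1)] and ye = killedD(2)[OF e(1) singletonI]
  have "y \<odot>\<^bsub>E ?i2\<^esub> d ?i1 e = \<zero>\<^bsub>E ?i2\<^esub>" "z \<odot>\<^bsub>E ?i2\<^esub> d ?i1 e = \<zero>\<^bsub>E ?i2\<^esub>"
    using d_smult[OF R(2) ec] d_smult[OF R(3) ec] ye e(2) qc by simp_all
  then have "d ?i1 e \<in> killed {y, z} ?i2" using ec by (simp add: killed_def)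
  from lift_x[OF this] obtain c where c: "c \<in> carrier (E ?i2)" "x \<odot>\<^bsub>E ?i2\<^esub> c = d ?i1 e" by blast
  have "x \<odot>\<^bsub>E ?i3\<^esub> d ?i2 c = \<zero>\<^bsub>E ?i3\<^esub>" using d_smult[OF R(1) c(1)] c(2) ec by simp
  then have "d ?i2 c \<in> cocycle {x} ?i3" using c by (simp add: cocycle_def killed_def)
  moreover have "d ?i2 c \<notin> d ?i2 ` killed {x} ?i2"
  proof
    assume "d ?i2 c \<in> d ?i2 ` killed {x} ?i2"
    then obtain g where g: "g \<in> carrier (E ?i2)" "x \<odot>\<^bsub>E ?i2\<^esub> g = \<zero>\<^bsub>E ?i2\<^esub>" "d ?i2 c = d ?i2 g"
      by (auto simp: killed_def)
    have "d ?i2 (c \<ominus>\<^bsub>E ?i2\<^esub> g) = \<zero>\<^bsub>E ?i3\<^esub>" using c g by (simp add: d_diff)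
    \<comment> \<open>Retrace the three steps: correct \<open>c\<close> by \<open>g\<close>, \<open>e\<close> by \<open>x h\<close>, and \<open>q\<close> by \<open>z m\<close>.\<close>
    then obtain h where h: "h \<in> carrier (E ?i1)" "d ?i1 h = c \<ominus>\<^bsub>E ?i2\<^esub> g"
      using primitive[of "c \<ominus>\<^bsub>E ?i2\<^esub> g" ?i1] c(1) g(1) by auto
    have "d ?i1 (x \<odot>\<^bsub>E ?i1\<^esub> h) = x \<odot>\<^bsub>E ?i2\<^esub> (c \<ominus>\<^bsub>E ?i2\<^esub> g)" using h R by (simp add: d_smult)
    also have "\<dots> = d ?i1 e" using R c g ec by (simp add: smult_diff)
    finally have "d ?i1 (e \<ominus>\<^bsub>E ?i1\<^esub> x \<odot>\<^bsub>E ?i1\<^esub> h) = \<zero>\<^bsub>E ?i2\<^esub>"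
      using ec h R by (simp add: d_diff)
    then obtain m where m: "m \<in> carrier (E i)" "d i m = e \<ominus>\<^bsub>E ?i1\<^esub> x \<odot>\<^bsub>E ?i1\<^esub> h"
      using primitive[of "e \<ominus>\<^bsub>E ?i1\<^esub> x \<odot>\<^bsub>E ?i1\<^esub> h" i] ec h(1) R(1) by auto
    have kill: "r \<odot>\<^bsub>E j\<^esub> (s \<odot>\<^bsub>E j\<^esub> w) = \<zero>\<^bsub>E j\<^esub>"
      if "r \<otimes> s = \<zero>" "r \<in> carrier R" "s \<in> carrier R" "w \<in> carrier (E j)" for r s w j
      using that by (metis E.smult_assoc1 E.smult_l_null)
    have yx: "y \<otimes> x = \<zero>" "z \<otimes> x = \<zero>" using R xy xz by (simp_all add: m_comm)
    have dym: "d i (y \<odot>\<^bsub>E i\<^esub> m) = \<zero>\<^bsub>E ?i1\<^esub>" and dzm: "d i (z \<odot>\<^bsub>E i\<^esub> m) = d i q"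
      using m R ec h(1) ye e(2) kill[OF yx(1)] kill[OF yx(2)] qc
      by (simp_all add: d_smult smult_diff)
    have t: "y \<odot>\<^bsub>E i\<^esub> m \<in> cocycle {x} i"
      using m(1) R dym kill[OF xy] by (simp add: cocycle_def killed_def)
    have s: "q \<ominus>\<^bsub>E i\<^esub> z \<odot>\<^bsub>E i\<^esub> m \<in> cocycle {x} i"
      using m(1) R dzm kill[OF xz] qc xq by (simp add: cocycle_def killed_def d_diff smult_diff)
    have "z \<odot>\<^bsub>E i\<^esub> (y \<odot>\<^bsub>E i\<^esub> m) = y \<odot>\<^bsub>E i\<^esub> (z \<odot>\<^bsub>E i\<^esub> m)"
      using m(1) R by (simp add: E.smult_assoc1[symmetric] m_comm)
    \<comment> \<open>\<open>a = y q = y (q - z m) + z (y m)\<close>, and both brackets are cocycles.\<close>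
    then have "y \<odot>\<^bsub>E i\<^esub> (q \<ominus>\<^bsub>E i\<^esub> z \<odot>\<^bsub>E i\<^esub> m) \<oplus>\<^bsub>E i\<^esub> z \<odot>\<^bsub>E i\<^esub> (y \<odot>\<^bsub>E i\<^esub> m) = a"
      using m(1) R qc q(2) cocycleD(2)[OF a] by (simp add: smult_diff) (simp add: E.minus_eq E.a_assoc E.l_neg)
    then show False using nontriv[OF s t] by simp
  qed
  ultimately show ?thesis unfolding ext_Suc_nonzero_def by blast
qed

text \<open>
  In positive degree \<open>y\<close> and \<open>z\<close> map cocycles to coboundaries: if \<open>s = d v\<close>, then \<open>y s = d (y v)\<close>, and
  \<open>y v\<close> is killed by \<open>x\<close> because \<open>x y = 0\<close>, even though \<open>v\<close> need not be.
\<close>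

lemma plane_line_ext_step:
  assumes R: "x \<in> carrier R" "y \<in> carrier R" "z \<in> carrier R"
    and xy: "x \<otimes> y = \<zero>" and xz: "x \<otimes> z = \<zero>"
    and lift_x: "\<And>b j. b \<in> killed {y, z} j \<Longrightarrow> \<exists>e \<in> carrier (E j). x \<odot>\<^bsub>E j\<^esub> e = b"
    and lift_y: "\<And>b j. b \<in> killed {x} j \<Longrightarrow> \<exists>e \<in> killed {x} j. y \<odot>\<^bsub>E j\<^esub> e = b"
    and lift_z: "\<And>b j. b \<in> killed {x, y} j \<Longrightarrow> \<exists>e \<in> killed {y} j. z \<odot>\<^bsub>E j\<^esub> e = b"
    and nonzero: "ext_Suc_nonzero {x} i"
  shows "ext_Suc_nonzero {x} (Suc (Suc (Suc i)))"
proof -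
  obtain a where a: "a \<in> cocycle {x} (Suc i)" "a \<notin> d i ` killed {x} i"
    using nonzero unfolding ext_Suc_nonzero_def by blast
  show ?thesis
  proof (rule plane_line_ext_from_cocycle[OF R xy xz lift_x lift_y lift_z a(1)])
    fix s t assume s: "s \<in> cocycle {x} (Suc i)" and t: "t \<in> cocycle {x} (Suc i)"
    obtain v where v: "v \<in> carrier (E i)" "d i v = s" using primitive[OF cocycleD(2,4)[OF s]] .
    obtain w where w: "w \<in> carrier (E i)" "d i w = t" using primitive[OF cocycleD(2,4)[OF t]] .
    have kill: "x \<odot>\<^bsub>E i\<^esub> (r \<odot>\<^bsub>E i\<^esub> u) = \<zero>\<^bsub>E i\<^esub>"
      if "x \<otimes> r = \<zero>" "r \<in> carrier R" "u \<in> carrier (E i)" for r u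
      using that R by (metis E.smult_assoc1 E.smult_l_null)
    have "y \<odot>\<^bsub>E i\<^esub> v \<oplus>\<^bsub>E i\<^esub> z \<odot>\<^bsub>E i\<^esub> w \<in> killed {x} i"
      using v w R kill[OF xy] kill[OF xz] by (simp add: killed_def E.smult_r_distr)
    moreover have "d i (y \<odot>\<^bsub>E i\<^esub> v \<oplus>\<^bsub>E i\<^esub> z \<odot>\<^bsub>E i\<^esub> w) = y \<odot>\<^bsub>E (Suc i)\<^esub> s \<oplus>\<^bsub>E (Suc i)\<^esub> z \<odot>\<^bsub>E (Suc i)\<^esub> t"
      using v w R by (simp add: d_add d_smult)
    ultimately show "y \<odot>\<^bsub>E (Suc i)\<^esub> s \<oplus>\<^bsub>E (Suc i)\<^esub> z \<odot>\<^bsub>E (Suc i)\<^esub> t \<noteq> a"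
      using a(2) by (metis imageI)
  qed
qed

end

section \<open>Monomial ideals\<close>

text \<open>
  The exponent vectors of the monomials in the ideal generated by the monomials with exponents in \<open>S\<close>.
\<close>

definition divisible_by :: "(nat \<Rightarrow>\<^sub>0 nat) set \<Rightarrow> (nat \<Rightarrow>\<^sub>0 nat) set" where
  "divisible_by S = {s + u | s u. s \<in> S}"

definition in_vars :: "nat \<Rightarrow> (nat \<Rightarrow>\<^sub>0 nat) set" where
  "in_vars n = {m. Poly_Mapping.keys m \<subseteq> {1..n}}"

definition monom :: "(nat \<Rightarrow>\<^sub>0 nat) \<Rightarrow> 'k::field mpoly" where
  "monom m = Poly_Mapping.single m 1"

lemma keys_add_nat: "Poly_Mapping.keys (a + b :: nat \<Rightarrow>\<^sub>0 nat) = Poly_Mapping.keys a \<union> Poly_Mapping.keys b"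
  by (auto simp: in_keys_iff lookup_add)

lemma divisible_by_iff: "m \<in> divisible_by S \<longleftrightarrow> (\<exists>s\<in>S. \<forall>i. Poly_Mapping.lookup s i \<le> Poly_Mapping.lookup m i)"
proof
  assume "\<exists>s\<in>S. \<forall>i. Poly_Mapping.lookup s i \<le> Poly_Mapping.lookup m i"
  then obtain s where s: "s \<in> S" "\<forall>i. Poly_Mapping.lookup s i \<le> Poly_Mapping.lookup m i" by blast
  have "m = s + (m - s)"
    using s(2) by (intro poly_mapping_eqI) (simp add: lookup_add lookup_minus)
  then show "m \<in> divisible_by S" using s(1) unfolding divisible_by_def by blast
qed (force simp: divisible_by_def lookup_add)

lemma divisible_by_self: "s \<in> S \<Longrightarrow> s \<in> divisible_by S"
  by (auto simp: divisible_by_iff)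

lemma divisible_by_add: "m \<in> divisible_by S \<Longrightarrow> u + m \<in> divisible_by S"
  by (force simp: divisible_by_iff lookup_add intro: trans_le_add2)

lemma mpoly_ring_simps [simp]:
  "p \<in> carrier (mpoly_ring k n) \<longleftrightarrow> Poly_Mapping.keys p \<subseteq> in_vars n"
  "mult (mpoly_ring k n) = (*)" "one (mpoly_ring k n) = 1"
  "zero (mpoly_ring k n) = 0" "add (mpoly_ring k n) = (+)"
  by (auto simp: mpoly_ring_def in_vars_def)

lemma poly_eq_sum_monom:
  "p = (\<Sum>m\<in>Poly_Mapping.keys p. Poly_Mapping.single m (Poly_Mapping.lookup p m))"
  by (rule poly_mapping_eqI)
     (auto simp: lookup_sum lookup_single when_def in_keys_iff)

lemma lookup_mult_monom: "Poly_Mapping.lookup (p * monom t) (m + t) = Poly_Mapping.lookup p m"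
proof -
  have "p * monom t = (\<Sum>l\<in>Poly_Mapping.keys p. Poly_Mapping.single (l + t) (Poly_Mapping.lookup p l))"
    by (subst poly_eq_sum_monom[of p]) (simp add: sum_distrib_right monom_def mult_single)
  then show ?thesis
    by (auto simp: lookup_sum lookup_single when_def in_keys_iff)
qed

theorem Idl_monom:
  assumes S: "S \<subseteq> in_vars n"
  shows "Idl\<^bsub>mpoly_ring k n\<^esub> (monom ` S) =
    {p \<in> carrier (mpoly_ring k n). Poly_Mapping.keys p \<subseteq> divisible_by S}"
    (is "?I = ?J")
proof -
  interpret P: cring "mpoly_ring k n" by (rule cring_mpoly_ring)
  have gens: "monom ` S \<subseteq> carrier (mpoly_ring k n)" using S by (auto simp: monom_def)
  interpret I: ideal ?I "mpoly_ring k n" by (rule P.genideal_ideal[OF gens])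
  have neg: "\<ominus>\<^bsub>mpoly_ring k n\<^esub> p = - p" if "p \<in> carrier (mpoly_ring k n)" for p
    using that by (intro P.minus_equality) auto
  have mult: "q * p \<in> ?J" if p: "p \<in> ?J" and q: "q \<in> carrier (mpoly_ring k n)" for p q
  proof -
    have "q * p \<in> carrier (mpoly_ring k n)" using P.m_closed[of q p] p q by simp
    moreover have "Poly_Mapping.keys (q * p) \<subseteq> divisible_by S"
      using p keys_mult[of q p] divisible_by_add by blast
    ultimately show ?thesis by blast
  qed
  have "ideal ?J (mpoly_ring k n)"
  proof (rule idealI)
    show "ring (mpoly_ring k n)" by (rule P.ring_axioms)
    show "subgroup ?J (add_monoid (mpoly_ring k n))"
    proof (rule P.add.subgroupI)
      show "?J \<noteq> {}" by (auto intro: exI[of _ 0])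
      fix p assume "p \<in> ?J"
      then show "\<ominus>\<^bsub>mpoly_ring k n\<^esub> p \<in> ?J" using neg[of p] by simp
    next
      fix p q assume "p \<in> ?J" "q \<in> ?J"
      then show "p \<oplus>\<^bsub>mpoly_ring k n\<^esub> q \<in> ?J" using keys_add[of p q] by auto
    qed auto
    fix p q assume "p \<in> ?J" "q \<in> carrier (mpoly_ring k n)"
    then show "q \<otimes>\<^bsub>mpoly_ring k n\<^esub> p \<in> ?J" "p \<otimes>\<^bsub>mpoly_ring k n\<^esub> q \<in> ?J"
      using mult[of p q] by (simp_all add: mult.commute)
  qed
  moreover have "monom ` S \<subseteq> ?J"
    using S by (auto simp: monom_def intro: divisible_by_self)
  ultimately have "?I \<subseteq> ?J" by (rule P.genideal_minimal)
  moreover have "?J \<subseteq> ?I"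
  proof
    fix p assume p: "p \<in> ?J"
    have "Poly_Mapping.single m c \<in> ?I" if m: "m \<in> Poly_Mapping.keys p" for m c
    proof -
      obtain s u where su: "m = s + u" "s \<in> S" using m p unfolding divisible_by_def by blast
      have "Poly_Mapping.keys u \<subseteq> Poly_Mapping.keys m" using su by (simp add: keys_add_nat)
      then have "Poly_Mapping.single u c \<in> carrier (mpoly_ring k n)"
        using m p by (auto simp: in_vars_def)
      moreover have "monom s \<in> ?I" using su(2) P.genideal_self[OF gens] by blast
      ultimately have "Poly_Mapping.single u c * monom s \<in> ?I" using I.I_l_closed by simp
      then show ?thesis by (simp add: su(1) monom_def mult_single add.commute)
    qed
    note term_in = this
    have "(\<Sum>m\<in>K. Poly_Mapping.single m (Poly_Mapping.lookup p m)) \<in> ?I" if "K \<subseteq> Poly_Mapping.keys p" "finite K" for K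
      using that(2,1)
    proof (induction K rule: finite_induct)
      case empty show ?case using I.zero_closed by simp
    next
      case (insert m K)
      then show ?case using I.a_closed term_in by simp
    qed
    then show "p \<in> ?I" using poly_eq_sum_monom[of p] finite_keys[of p] by (metis subset_refl)
  qed
  ultimately show ?thesis by blast
qed

lemma Idl_monom_lookup:
  assumes "S \<subseteq> in_vars n" "p \<in> Idl\<^bsub>mpoly_ring k n\<^esub> (monom ` S)" "m \<notin> divisible_by S"
  shows "Poly_Mapping.lookup p m = 0"
  using assms by (auto simp: Idl_monom in_keys_iff)

text \<open>
  Multiplication by a monomial only shifts exponents, so the colon ideal of a monomial ideal by a
  monomial can be computed on exponents.
\<close>

lemma Idl_monom_colon:
  assumes S: "S \<subseteq> in_vars n" and T: "T \<subseteq> in_vars n"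
    and colon: "\<And>m. m \<in> in_vars n \<Longrightarrow> m + t \<in> divisible_by S \<Longrightarrow> m \<in> divisible_by T"
    and p: "p \<in> carrier (mpoly_ring k n)" "p * monom t \<in> Idl\<^bsub>mpoly_ring k n\<^esub> (monom ` S)"
  shows "p \<in> Idl\<^bsub>mpoly_ring k n\<^esub> (monom ` T)"
proof -
  have "m \<in> divisible_by T" if "m \<in> Poly_Mapping.keys p" for m
  proof (rule colon)
    show "m \<in> in_vars n" using that p(1) by auto
    show "m + t \<in> divisible_by S"
      using Idl_monom_lookup[OF S p(2)] that by (metis in_keys_iff lookup_mult_monom)
  qed
  then show ?thesis using p(1) T by (auto simp: Idl_monom)
qed

lemma mpoly_ring_minus:
  assumes "p \<in> carrier (mpoly_ring k n)" "q \<in> carrier (mpoly_ring k n)"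
  shows "p \<ominus>\<^bsub>mpoly_ring k n\<^esub> q = p - q"
proof -
  interpret P: cring "mpoly_ring k n" by (rule cring_mpoly_ring)
  have "\<ominus>\<^bsub>mpoly_ring k n\<^esub> q = - q"
    using assms by (intro P.minus_equality) auto
  then show ?thesis by (simp add: P.minus_eq)
qed

lemma lookup_mult_monom_not_divisible:
  assumes "m \<notin> divisible_by {t}"
  shows "Poly_Mapping.lookup (p * monom t) m = 0"
proof (rule ccontr)
  assume "Poly_Mapping.lookup (p * monom t) m \<noteq> 0"
  then have "m \<in> Poly_Mapping.keys (p * monom t)" by (simp add: in_keys_iff)
  then obtain u where "m = u + t" using keys_mult[of p "monom t"] by (auto simp: monom_def split: if_splits)
  then show False using assms by (auto simp: divisible_by_iff lookup_add)
qed

section \<open>Quotients by monomial ideals\<close>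

locale monomial_quotient =
  fixes k :: "'k::field itself" and n :: nat and U :: "(nat \<Rightarrow>\<^sub>0 nat) set"
  assumes U: "U \<subseteq> in_vars n"
begin

definition P :: "'k mpoly ring" where "P = mpoly_ring k n"

definition I :: "'k mpoly set" where "I = Idl\<^bsub>P\<^esub> (monom ` U)"

definition R :: "'k mpoly set ring" where "R = P Quot I"

definition cls :: "'k mpoly \<Rightarrow> 'k mpoly set" where "cls p = I +>\<^bsub>P\<^esub> p"

sublocale P: cring P unfolding P_def by (rule cring_mpoly_ring)

lemma P_simps [simp]:
  "p \<in> carrier P \<longleftrightarrow> Poly_Mapping.keys p \<subseteq> in_vars n"
  "mult P = (*)" "one P = 1" "zero P = 0" "add P = (+)"
  by (auto simp: P_def)

lemma monom_closed: "m \<in> in_vars n \<Longrightarrow> monom m \<in> carrier P"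
  by (simp add: monom_def)

lemma ideal_Idl_monom: "S \<subseteq> in_vars n \<Longrightarrow> ideal (Idl\<^bsub>P\<^esub> (monom ` S)) P"
  using monom_closed by (intro P.genideal_ideal) blast

sublocale I: ideal I P unfolding I_def by (rule ideal_Idl_monom[OF U])

sublocale R: cring R unfolding R_def by (rule I.quotient_is_cring[OF P.is_cring])

lemma cls_hom: "ring_hom_ring P R cls"
  using I.rcos_ring_hom_ring unfolding R_def cls_def by (simp add: eta_contract_eq)

lemma cls_closed [simp]: "p \<in> carrier P \<Longrightarrow> cls p \<in> carrier R"
  and cls_add: "p \<in> carrier P \<Longrightarrow> q \<in> carrier P \<Longrightarrow> cls (p + q) = cls p \<oplus>\<^bsub>R\<^esub> cls q"
  and cls_mult: "p \<in> carrier P \<Longrightarrow> q \<in> carrier P \<Longrightarrow> cls (p * q) = cls p \<otimes>\<^bsub>R\<^esub> cls q"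
  using ring_hom_ring.homh[OF cls_hom] unfolding ring_hom_def by auto

lemma cls_surj:
  assumes "r \<in> carrier R" obtains p where "p \<in> carrier P" "r = cls p"
  using assms unfolding R_def cls_def FactRing_def A_RCOSETS_def' by auto

lemma cls_eq_iff:
  "p \<in> carrier P \<Longrightarrow> q \<in> carrier P \<Longrightarrow> cls p = cls q \<longleftrightarrow> p - q \<in> I"
  unfolding cls_def using P.quotient_eq_iff_same_a_r_cos[OF I.ideal_axioms, of p q] mpoly_ring_minus
  unfolding P_def by metis

lemma zero_R: "\<zero>\<^bsub>R\<^esub> = cls 0"
  using ring_hom_zero[OF ring_hom_ring.homh[OF cls_hom] P.ring_axioms R.ring_axioms] by simp

lemma cls_eq_zero_iff: "p \<in> carrier P \<Longrightarrow> cls p = \<zero>\<^bsub>R\<^esub> \<longleftrightarrow> p \<in> I"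
  using cls_eq_iff[of p 0] by (simp add: zero_R)

lemma monom_in_I: "m \<in> U \<Longrightarrow> monom m \<in> I"
  unfolding I_def using P.genideal_self[of "monom ` U"] monom_closed U by blast

lemma monom_mult: "monom a * monom b = (monom (a + b) :: 'k mpoly)"
  by (simp add: monom_def mult_single)

lemma lookup_eq_zero_if_in_I: "p \<in> I \<Longrightarrow> m \<notin> divisible_by U \<Longrightarrow> Poly_Mapping.lookup p m = 0"
  unfolding I_def P_def by (rule Idl_monom_lookup[OF U])

text \<open>
  This combines \<open>injective_module_solve\<close> with the computation of colon ideals: all that remains to be
  checked is that \<open>((U) + (S) : t) \<subseteq> (T)\<close>, a statement about exponent vectors. Polynomials that
  annihilate \<open>a\<close> form an ideal, so it is enough that \<open>a\<close> is killed by the monomials in \<open>T\<close>.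
\<close>

theorem injective_module_lift_monom:
  fixes E :: "('k mpoly set, 'm) module"
  assumes inj: "injective_module R E"
    and vars: "S \<subseteq> in_vars n" "T \<subseteq> in_vars n" "t \<in> in_vars n"
    and colon: "\<And>m. m \<in> in_vars n \<Longrightarrow> m + t \<in> divisible_by (U \<union> S) \<Longrightarrow> m \<in> divisible_by T"
    and a: "a \<in> carrier E" and kill: "\<And>s. s \<in> T \<Longrightarrow> cls (monom s) \<odot>\<^bsub>E\<^esub> a = \<zero>\<^bsub>E\<^esub>"
  shows "\<exists>e \<in> carrier E. cls (monom t) \<odot>\<^bsub>E\<^esub> e = a \<and>
    (\<forall>s \<in> S. cls (monom s) \<odot>\<^bsub>E\<^esub> e = \<zero>\<^bsub>E\<^esub>)"
proof -
  interpret E: module R E using inj by (simp add: injective_module_def)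
  let ?J = "Idl\<^bsub>P\<^esub> (monom ` (U \<union> S)) :: 'k mpoly set"
  have US: "U \<union> S \<subseteq> in_vars n" using U vars by blast
  interpret J: ideal ?J P by (rule ideal_Idl_monom[OF US])
  have gens: "monom ` (U \<union> S) \<subseteq> carrier P" using US monom_closed by blast
  have IJ: "I \<subseteq> ?J" unfolding I_def
    by (rule P.genideal_minimal[OF J.ideal_axioms]) (use P.genideal_self[OF gens] in blast)
  have J: "ideal (cls ` ?J) R"
    using P.ring_ideal_imp_quot_ideal[OF I.ideal_axioms J.ideal_axioms]
    unfolding R_def cls_def by (simp add: eta_contract_eq)
  have ann: "cls p \<odot>\<^bsub>E\<^esub> a = \<zero>\<^bsub>E\<^esub>" if p: "p \<in> Idl\<^bsub>P\<^esub> (monom ` T)" for p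
  proof -
    have "ideal {p \<in> carrier P. cls p \<odot>\<^bsub>E\<^esub> a = \<zero>\<^bsub>E\<^esub>} P"
    proof (rule idealI)
      show "ring P" by (rule P.ring_axioms)
      show "subgroup {p \<in> carrier P. cls p \<odot>\<^bsub>E\<^esub> a = \<zero>\<^bsub>E\<^esub>} (add_monoid P)"
      proof (rule P.add.subgroupI)
        show "{p \<in> carrier P. cls p \<odot>\<^bsub>E\<^esub> a = \<zero>\<^bsub>E\<^esub>} \<noteq> {}"
          using a zero_R E.smult_l_null by (auto intro!: exI[of _ 0])
        fix p assume p: "p \<in> {p \<in> carrier P. cls p \<odot>\<^bsub>E\<^esub> a = \<zero>\<^bsub>E\<^esub>}"
        have "\<ominus>\<^bsub>P\<^esub> p = (\<ominus>\<^bsub>P\<^esub> \<one>\<^bsub>P\<^esub>) * p"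
          using p P.l_minus[OF P.one_closed, of p] by simp
        then show "\<ominus>\<^bsub>P\<^esub> p \<in> {p \<in> carrier P. cls p \<odot>\<^bsub>E\<^esub> a = \<zero>\<^bsub>E\<^esub>}"
          using p a P.a_inv_closed[of p] P.a_inv_closed[OF P.one_closed]
            cls_mult[of "\<ominus>\<^bsub>P\<^esub> \<one>\<^bsub>P\<^esub>" p] E.smult_assoc1[of "cls (\<ominus>\<^bsub>P\<^esub> \<one>\<^bsub>P\<^esub>)" "cls p" a]
          by simp
      next
        fix p q assume "p \<in> {p \<in> carrier P. cls p \<odot>\<^bsub>E\<^esub> a = \<zero>\<^bsub>E\<^esub>}"
          "q \<in> {p \<in> carrier P. cls p \<odot>\<^bsub>E\<^esub> a = \<zero>\<^bsub>E\<^esub>}"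
        then show "p \<oplus>\<^bsub>P\<^esub> q \<in> {p \<in> carrier P. cls p \<odot>\<^bsub>E\<^esub> a = \<zero>\<^bsub>E\<^esub>}"
          using a P.a_closed[of p q] cls_add[of p q] E.smult_l_distr[of "cls p" "cls q" a] by simp
      qed auto
      fix p q assume pq: "p \<in> {p \<in> carrier P. cls p \<odot>\<^bsub>E\<^esub> a = \<zero>\<^bsub>E\<^esub>}" "q \<in> carrier P"
      then show 1: "q \<otimes>\<^bsub>P\<^esub> p \<in> {p \<in> carrier P. cls p \<odot>\<^bsub>E\<^esub> a = \<zero>\<^bsub>E\<^esub>}"
        using a P.m_closed[of q p] cls_mult[of q p] E.smult_assoc1[of "cls q" "cls p" a] by simp
      then show "p \<otimes>\<^bsub>P\<^esub> q \<in> {p \<in> carrier P. cls p \<odot>\<^bsub>E\<^esub> a = \<zero>\<^bsub>E\<^esub>}"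
        by (simp add: mult.commute)
    qed
    moreover have "monom ` T \<subseteq> {p \<in> carrier P. cls p \<odot>\<^bsub>E\<^esub> a = \<zero>\<^bsub>E\<^esub>}"
      using kill vars(2) monom_closed by blast
    ultimately show ?thesis using P.genideal_minimal p by blast
  qed
  have "r \<odot>\<^bsub>E\<^esub> a = \<zero>\<^bsub>E\<^esub>" if r: "r \<in> carrier R" "r \<otimes>\<^bsub>R\<^esub> cls (monom t) \<in> cls ` ?J" for r
  proof -
    obtain p where p: "p \<in> carrier P" "r = cls p" using cls_surj[OF r(1)] .
    have pt: "p * monom t \<in> carrier P" using P.m_closed[OF p(1) monom_closed[OF vars(3)]] by simp
    obtain j where j: "j \<in> ?J" "cls (p * monom t) = cls j"
      using r(2) p cls_mult monom_closed[OF vars(3)] by auto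
    have "p * monom t - j \<in> ?J" using j cls_eq_iff[OF pt J.a_Hcarr[OF j(1)]] IJ by blast
    then have "p * monom t \<in> ?J" using J.a_closed[OF _ j(1), of "p * monom t - j"] by simp
    then have "p \<in> Idl\<^bsub>P\<^esub> (monom ` T)"
      using Idl_monom_colon[OF US vars(2) colon] p(1) unfolding P_def by blast
    then show ?thesis using ann p(2) by blast
  qed
  then obtain e where e: "e \<in> carrier E" "cls (monom t) \<odot>\<^bsub>E\<^esub> e = a"
      "\<And>j. j \<in> cls ` ?J \<Longrightarrow> j \<odot>\<^bsub>E\<^esub> e = \<zero>\<^bsub>E\<^esub>"
    using injective_module_solve[OF inj J cls_closed[OF monom_closed[OF vars(3)]] a] by metis
  have "cls (monom s) \<in> cls ` ?J" if "s \<in> S" for s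
    using P.genideal_self[OF gens] that by blast
  then have "\<forall>s\<in>S. cls (monom s) \<odot>\<^bsub>E\<^esub> e = \<zero>\<^bsub>E\<^esub>" using e(3) by simp
  then show ?thesis using e(1,2) by (intro bexI[of _ e] conjI)
qed

end

section \<open>Infinite injective dimension from persistent cohomology\<close>

lemma acyclic_module_complexI:
  assumes "cring R" "injective_resolution R M E e d"
  shows "acyclic_module_complex R E d"
  using assms
  by (simp add: injective_resolution_def injective_module_def acyclic_module_complex_def
      acyclic_module_complex_axioms_def)

text \<open>
  \<open>Ext\<^sup>0(R/(S), R) = Hom(R/(S), R)\<close> is the annihilator of \<open>S\<close> in \<open>R\<close>.
\<close>

lemma cocycle_0_iff:
  fixes R :: "('r, 's) ring_scheme" (structure)
  assumes R: "cring R" and res: "injective_resolution R (regular_module R) E e d"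
    and S: "S \<subseteq> carrier R"
  shows "a \<in> acyclic_module_complex.cocycle E d S 0 \<longleftrightarrow>
    (\<exists>r \<in> carrier R. a = e r \<and> (\<forall>s\<in>S. s \<otimes> r = \<zero>))"
proof -
  interpret C: acyclic_module_complex R E d by (rule acyclic_module_complexI[OF R res])
  have e: "r \<in> carrier R \<Longrightarrow> e r \<in> carrier (E 0)"
    "r \<in> carrier R \<Longrightarrow> s \<in> carrier R \<Longrightarrow> e (s \<otimes> r) = s \<odot>\<^bsub>E 0\<^esub> e r" for r s
    using res by (auto simp: injective_resolution_def module_hom_def regular_module_def)
  have inj: "inj_on e (carrier R)" and img: "e ` carrier R = a_kernel (E 0) (E 1) (d 0)"
    using res by (auto simp: injective_resolution_def regular_module_def)
  have e0: "e \<zero> = \<zero>\<^bsub>E 0\<^esub>"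
    using e(2)[of \<zero> \<zero>] e(1)[of \<zero>] C.E.smult_l_null[of "e \<zero>" 0] by simp
  have "s \<odot>\<^bsub>E 0\<^esub> e r = \<zero>\<^bsub>E 0\<^esub> \<longleftrightarrow> s \<otimes> r = \<zero>" if "r \<in> carrier R" "s \<in> carrier R" for r s
    using that inj_on_eq_iff[OF inj, of "s \<otimes> r" \<zero>] by (simp add: e(2) e0)
  moreover have "a \<in> C.cocycle S 0 \<longleftrightarrow>
      a \<in> e ` carrier R \<and> (\<forall>s\<in>S. s \<odot>\<^bsub>E 0\<^esub> a = \<zero>\<^bsub>E 0\<^esub>)"
    unfolding img a_kernel_def' C.cocycle_def C.killed_def by auto
  ultimately show ?thesis using S by blast
qed

text \<open>
  In a finite resolution the cohomology vanishes above its length, so it suffices that nonvanishing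
  in some degree propagates to a higher one.
\<close>

lemma injective_dimension_infinite:
  fixes R :: "('r, 's) ring_scheme" (structure)
  assumes R: "cring R" and S: "S \<subseteq> carrier R"
    and base: "\<And>(E :: nat \<Rightarrow> ('r, 'm) module) e d. injective_resolution R M E e d \<Longrightarrow>
      \<exists>i. acyclic_module_complex.ext_Suc_nonzero E d S i"
    and step: "\<And>(E :: nat \<Rightarrow> ('r, 'm) module) e d i. injective_resolution R M E e d \<Longrightarrow>
      acyclic_module_complex.ext_Suc_nonzero E d S i \<Longrightarrow>
      \<exists>j>i. acyclic_module_complex.ext_Suc_nonzero E d S j"
  shows "injective_dimension TYPE('m) R M = \<infinity>"
proof -
  have False
    if res: "injective_resolution R M E e d" and fin: "\<forall>i>N. carrier (E i) = {\<zero>\<^bsub>E i\<^esub>}"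
    for E :: "nat \<Rightarrow> ('r, 'm) module" and e d N
  proof -
    interpret C: acyclic_module_complex R E d by (rule acyclic_module_complexI[OF R res])
    have "\<exists>i\<ge>m. C.ext_Suc_nonzero S i" for m
    proof (induction m)
      case 0 show ?case using base[OF res] by simp
    next
      case (Suc m) then show ?case using step[OF res] by (meson le_less_trans Suc_leI)
    qed
    then obtain i where "i \<ge> N" "C.ext_Suc_nonzero S i" by blast
    then show False using C.ext_Suc_zero[OF _ S, of i] fin by simp
  qed
  then have "{enat N | N. \<exists>(E :: nat \<Rightarrow> ('r, 'm) module) e d.
      injective_resolution R M E e d \<and> (\<forall>i>N. carrier (E i) = {\<zero>\<^bsub>E i\<^esub>})} = {}" by blast
  then show ?thesis unfolding injective_dimension_def by (simp add: Inf_enat_def)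
qed

section \<open>The residue field when a variable lies in the socle\<close>

abbreviation var_exp :: "nat \<Rightarrow> nat \<Rightarrow>\<^sub>0 nat" where
  "var_exp i \<equiv> Poly_Mapping.single i 1"

lemma var_exp_in_vars: "i \<in> {1..n} \<Longrightarrow> var_exp i \<in> in_vars n"
  by (simp add: in_vars_def)

lemma var_exp_le_iff: "(\<forall>i. Poly_Mapping.lookup (var_exp j) i \<le> f i) \<longleftrightarrow> 1 \<le> f j"
  by (auto simp: lookup_single when_def)

lemma divisible_by_vars_iff:
  "m \<in> divisible_by (var_exp ` J) \<longleftrightarrow> (\<exists>j\<in>J. 1 \<le> Poly_Mapping.lookup m j)"
  by (simp only: divisible_by_iff bex_simps var_exp_le_iff)

lemma var_exp_add_le_iff:
  "a \<noteq> b \<Longrightarrow> (\<forall>i. Poly_Mapping.lookup (var_exp a + var_exp b) i \<le> f i) \<longleftrightarrow> 1 \<le> f a \<and> 1 \<le> f b"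
  by (auto simp: lookup_add lookup_single when_def)

lemma var_exp_not_divisible_by_products:
  assumes "\<And>u. u \<in> U \<Longrightarrow> \<exists>a b. u = var_exp a + var_exp b"
  shows "var_exp j \<notin> divisible_by U"
proof
  assume "var_exp j \<in> divisible_by U"
  then obtain u a b where u: "\<forall>i. Poly_Mapping.lookup u i \<le> Poly_Mapping.lookup (var_exp j) i"
    "u = var_exp a + var_exp b" using assms unfolding divisible_by_iff by blast
  have "Poly_Mapping.lookup u a \<le> Poly_Mapping.lookup (var_exp j) a"
    "Poly_Mapping.lookup u b \<le> Poly_Mapping.lookup (var_exp j) b" using u(1) by blast+
  then show False unfolding u(2)
    by (auto simp: lookup_add lookup_single when_def split: if_splits)
qed

context monomial_quotient
begin

text \<open>
  Here \<open>U\<close> contains every \<open>x\<^sub>j x\<^sub>1\<close> and no variable is in the ideal generated by \<open>U\<close>. Since \<open>x\<^sub>1\<close> is in the socle,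
  \<open>(x\<^sub>2, \<dots>, x\<^sub>n) : x\<^sub>1 = (x\<^sub>1, \<dots>, x\<^sub>n)\<close>. The first class is that of \<open>x\<^sub>1 \<in> Hom(k, R)\<close>: if
  \<open>x\<^sub>1 p = x\<^sub>1\<close> in \<open>R\<close>, then \<open>p\<close> has constant coefficient \<open>1\<close>, so \<open>x\<^sub>2 p \<noteq> 0\<close>.
\<close>

theorem injective_dimension_infinite_if_variable_in_socle:
  assumes n: "n \<ge> 2" and soc: "\<And>j. j \<in> {1..n} \<Longrightarrow> var_exp j + var_exp 1 \<in> U"
    and lin: "\<And>j. j \<in> {1..n} \<Longrightarrow> var_exp j \<notin> divisible_by U"
  shows "injective_dimension TYPE('m) R (regular_module R) = \<infinity>"
proof -
  define v where "v j = cls (monom (var_exp j))" for j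
  define S where "S = v ` {2..n}"
  have vars: "insert 1 {2..n} = {1..n}" using n by auto
  have c: "monom (var_exp j) \<in> carrier P" if "j \<in> {1..n}" for j
    using that by (intro monom_closed var_exp_in_vars)
  then have vc: "j \<in> {1..n} \<Longrightarrow> v j \<in> carrier R" for j
    unfolding v_def by (intro cls_closed)
  have x: "v 1 \<in> carrier R" using vc n by simp
  have xS: "insert (v 1) S = v ` {1..n}" unfolding S_def vars[symmetric] by simp
  have S: "S \<subseteq> carrier R" using vc by (auto simp: S_def)
  have nil: "t \<otimes>\<^bsub>R\<^esub> v 1 = \<zero>\<^bsub>R\<^esub>" if t: "t \<in> insert (v 1) S" for t
  proof -
    obtain j where j: "j \<in> {1..n}" "t = v j" using t unfolding xS by blast
    have "t \<otimes>\<^bsub>R\<^esub> v 1 = cls (monom (var_exp j + var_exp 1))"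
      unfolding j(2) v_def using cls_mult[OF c[OF j(1)] c[of 1]] n by (simp add: monom_mult)
    moreover have "monom (var_exp j + var_exp 1) \<in> I" by (rule monom_in_I[OF soc[OF j(1)]])
    ultimately show ?thesis using cls_eq_zero_iff I.a_Hcarr by metis
  qed
  have lift: "\<exists>e \<in> acyclic_module_complex.killed E S j. v 1 \<odot>\<^bsub>E j\<^esub> e = b"
    if res: "injective_resolution R (regular_module R) E e d" and b: "b \<in> acyclic_module_complex.killed E (insert (v 1) S) j"
    for E :: "nat \<Rightarrow> ('k mpoly set, 'm) module" and e d b j
  proof -
    interpret C: acyclic_module_complex R E d by (rule acyclic_module_complexI[OF R.is_cring res])
    have inj: "injective_module R (E j)" using res by (simp add: injective_resolution_def)
    have "\<exists>e \<in> carrier (E j). cls (monom (var_exp 1)) \<odot>\<^bsub>E j\<^esub> e = b \<and>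
      (\<forall>s \<in> var_exp ` {2..n}. cls (monom s) \<odot>\<^bsub>E j\<^esub> e = \<zero>\<^bsub>E j\<^esub>)"
    proof (rule injective_module_lift_monom[OF inj])
      show "var_exp ` {2..n} \<subseteq> in_vars n" "var_exp ` {1..n} \<subseteq> in_vars n" "var_exp 1 \<in> in_vars n"
        using n by (auto simp: in_vars_def)
      show "b \<in> carrier (E j)" using C.killedD(1)[OF b] .
      show "cls (monom s) \<odot>\<^bsub>E j\<^esub> b = \<zero>\<^bsub>E j\<^esub>" if s: "s \<in> var_exp ` {1..n}" for s
      proof -
        obtain i where "i \<in> {1..n}" "s = var_exp i" using s by blast
        then show ?thesis using C.killedD(2)[OF b, of "v i"] unfolding xS by (simp add: v_def)
      qed
      fix m assume m: "m \<in> in_vars n" "m + var_exp 1 \<in> divisible_by (U \<union> var_exp ` {2..n})"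
      show "m \<in> divisible_by (var_exp ` {1..n})"
      proof (rule ccontr)
        assume "m \<notin> divisible_by (var_exp ` {1..n})"
        then have "Poly_Mapping.lookup m i = 0" if "i \<in> {1..n}" for i
          using that unfolding divisible_by_vars_iff by (simp add: Suc_le_eq)
        moreover have "Poly_Mapping.lookup m i = 0" if "i \<notin> {1..n}" for i
          using that m(1) unfolding in_vars_def by (meson in_keys_iff mem_Collect_eq subsetD)
        ultimately have "m = 0" by (intro poly_mapping_eqI) (metis lookup_zero)
        then have "var_exp 1 \<in> divisible_by (var_exp ` {2..n})"
          using m(2) lin[of 1] n by (auto simp: divisible_by_def)
        then show False unfolding divisible_by_vars_iff by (auto simp: lookup_single)
      qed
    qed
    then show ?thesis unfolding C.killed_def S_def v_def by auto
  qed
  show ?thesis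
  proof (rule injective_dimension_infinite[OF R.is_cring, of "insert (v 1) S"])
    show "insert (v 1) S \<subseteq> carrier R" using x S by blast
    fix E :: "nat \<Rightarrow> ('k mpoly set, 'm) module" and e d
    assume res: "injective_resolution R (regular_module R) E e d"
    interpret C: acyclic_module_complex R E d by (rule acyclic_module_complexI[OF R.is_cring res])
    have "C.ext_Suc_nonzero (insert (v 1) S) 0"
    proof (rule C.residue_ext_from_cocycle[OF x S lift[OF res]])
      show "e (v 1) \<in> C.cocycle (insert (v 1) S) 0"
        unfolding cocycle_0_iff[OF R.is_cring res insert_subset[THEN iffD2, OF conjI[OF x S]]]
        using x nil by blast
      fix r' assume "r' \<in> C.cocycle S 0"
      then obtain r where r: "r \<in> carrier R" "r' = e r" "\<forall>s\<in>S. s \<otimes>\<^bsub>R\<^esub> r = \<zero>\<^bsub>R\<^esub>"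
        unfolding cocycle_0_iff[OF R.is_cring res S] by blast
      obtain p where p: "p \<in> carrier P" "r = cls p" using cls_surj[OF r(1)] .
      show "v 1 \<odot>\<^bsub>E 0\<^esub> r' \<noteq> e (v 1)"
      proof
        assume eq: "v 1 \<odot>\<^bsub>E 0\<^esub> r' = e (v 1)"
        have "v 1 \<odot>\<^bsub>E 0\<^esub> r' = e (v 1 \<otimes>\<^bsub>R\<^esub> r)" and inj: "inj_on e (carrier R)"
          using res r(1) x unfolding r(2)
          by (auto simp: injective_resolution_def module_hom_def regular_module_def)
        then have "v 1 \<otimes>\<^bsub>R\<^esub> r = v 1" using eq inj_onD[OF inj] x r(1) by simp
        then have "cls (p * monom (var_exp 1)) = cls (monom (var_exp 1))"
          unfolding p(2) v_def using cls_mult[OF p(1) c, of 1] n R.m_comm p(1) c by simp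
        then have 1: "p * monom (var_exp 1) - monom (var_exp 1) \<in> I"
          using cls_eq_iff[OF P.m_closed[OF p(1) c[of 1]] c[of 1]] n by simp
        have "v 2 \<otimes>\<^bsub>R\<^esub> r = \<zero>\<^bsub>R\<^esub>" using r(3) n by (simp add: S_def)
        then have "cls (p * monom (var_exp 2)) = \<zero>\<^bsub>R\<^esub>"
          unfolding p(2) v_def using cls_mult[OF p(1) c, of 2] n R.m_comm p(1) c by simp
        then have 2: "p * monom (var_exp 2) \<in> I"
          using cls_eq_zero_iff[OF P.m_closed[OF p(1) c[of 2]]] n by simp
        have "Poly_Mapping.lookup p 0 = 1"
          using lookup_eq_zero_if_in_I[OF 1 lin, of 1] n lookup_mult_monom[of p "var_exp 1" 0]
          by (simp add: lookup_minus monom_def)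
        moreover have "Poly_Mapping.lookup p 0 = 0"
          using lookup_eq_zero_if_in_I[OF 2 lin, of 2] n lookup_mult_monom[of p "var_exp 2" 0] by simp
        ultimately show False by simp
      qed
    qed
    then show "\<exists>i. C.ext_Suc_nonzero (insert (v 1) S) i" ..
    fix i assume "C.ext_Suc_nonzero (insert (v 1) S) i"
    then have "C.ext_Suc_nonzero (insert (v 1) S) (Suc i)"
      by (rule C.residue_ext_step[OF x S lift[OF res] nil, rotated -1])
    then show "\<exists>j>i. C.ext_Suc_nonzero (insert (v 1) S) j" by blast
  qed
qed

end

lemma mpoly_var_mult_eq: "mpoly_var i * mpoly_var j = monom (var_exp i + var_exp j)"
  by (simp add: mpoly_var_def monom_def mult_single)

section \<open>The three rings\<close>

text \<open>
  A plane and a line through one point. The colon ideals needed are \<open>(0 : x) = (y, z)\<close>, \<open>((x) : y) = (x)\<close>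
  and \<open>((y) : z) = (x, y)\<close>. The first class is that of \<open>y \<in> Hom(R/(x), R)\<close>: in \<open>y = y p + z q\<close> the
  constant coefficient of \<open>p\<close> would be \<open>1\<close>, but \<open>x p = 0\<close> forces it to be \<open>0\<close>.
\<close>

lemma injective_dimension_plane_line:
  fixes k :: "'k::field itself"
  defines "R \<equiv> mpoly_ring k 3 Quot (Idl\<^bsub>mpoly_ring k 3\<^esub>
    {mpoly_var 1 * mpoly_var 2, mpoly_var 1 * mpoly_var 3})"
  shows "injective_dimension TYPE('m) R (regular_module R) = \<infinity>"
proof -
  define U where "U = {var_exp 1 + var_exp 2, var_exp 1 + var_exp 3}"
  interpret Q: monomial_quotient k 3 U
    by unfold_locales (auto simp: U_def in_vars_def keys_add_nat)
  have "{mpoly_var 1 * mpoly_var 2, mpoly_var 1 * mpoly_var 3 :: 'k mpoly} = monom ` U"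
    by (simp add: U_def mpoly_var_mult_eq)
  then have R: "R = Q.R" unfolding R_def Q.R_def Q.I_def Q.P_def by simp
  define v where "v j = Q.cls (monom (var_exp j))" for j
  have c: "monom (var_exp j) \<in> carrier Q.P" if "j \<in> {1, 2, 3}" for j
    using that by (intro Q.monom_closed var_exp_in_vars) auto
  have v: "v 1 \<in> carrier Q.R" "v 2 \<in> carrier Q.R" "v 3 \<in> carrier Q.R"
    unfolding v_def by (intro Q.cls_closed c; simp)+
  have prod: "v 1 \<otimes>\<^bsub>Q.R\<^esub> v j = \<zero>\<^bsub>Q.R\<^esub>" if "j \<in> {2, 3}" for j
  proof -
    have "v 1 \<otimes>\<^bsub>Q.R\<^esub> v j = Q.cls (monom (var_exp 1 + var_exp j))"
      unfolding v_def using Q.cls_mult[OF c[of 1] c[of j]] that by (auto simp: Q.monom_mult)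
    moreover have "monom (var_exp 1 + var_exp j) \<in> Q.I"
      using that by (intro Q.monom_in_I) (auto simp: U_def)
    ultimately show ?thesis using Q.cls_eq_zero_iff Q.I.a_Hcarr by metis
  qed
  have le: "(\<forall>i. Poly_Mapping.lookup (var_exp 1 + var_exp 2) i \<le> f i) \<longleftrightarrow> 1 \<le> f 1 \<and> 1 \<le> f 2"
    "(\<forall>i. Poly_Mapping.lookup (var_exp 1 + var_exp 3) i \<le> f i) \<longleftrightarrow> 1 \<le> f 1 \<and> 1 \<le> f 3" for f
    by (rule var_exp_add_le_iff; simp)+
  have divisible: "m \<in> divisible_by (U \<union> S) \<longleftrightarrow>
      1 \<le> Poly_Mapping.lookup m 1 \<and> (1 \<le> Poly_Mapping.lookup m 2 \<or> 1 \<le> Poly_Mapping.lookup m 3)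
      \<or> m \<in> divisible_by S" for m S
    by (simp only: divisible_by_iff U_def bex_Un bex_simps le) blast
  have lift: "\<exists>e \<in> acyclic_module_complex.killed E (v ` J) i. v t \<odot>\<^bsub>E i\<^esub> e = b"
    \<comment> \<open>One equation \<open>v t e = b\<close>, \<open>J e = 0\<close> for each colon ideal \<open>((J) : v t) = (K)\<close>.\<close>
    if res: "injective_resolution Q.R (regular_module Q.R) E e d" and b: "b \<in> acyclic_module_complex.killed E (v ` K) i"
      and JK: "(t, J, K) \<in> {(1, {}, {2, 3}), (2, {1}, {1}), (3, {2}, {1, 2})}"
    for E :: "nat \<Rightarrow> ('k mpoly set, 'm) module" and e d b i t J K
  proof -
    interpret C: acyclic_module_complex Q.R E d by (rule acyclic_module_complexI[OF Q.R.is_cring res])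
    have inj: "injective_module Q.R (E i)" using res by (simp add: injective_resolution_def)
    have "\<exists>e \<in> carrier (E i). Q.cls (monom (var_exp t)) \<odot>\<^bsub>E i\<^esub> e = b \<and>
      (\<forall>s \<in> var_exp ` J. Q.cls (monom s) \<odot>\<^bsub>E i\<^esub> e = \<zero>\<^bsub>E i\<^esub>)"
    proof (rule Q.injective_module_lift_monom[OF inj])
      show "var_exp ` J \<subseteq> in_vars 3" "var_exp ` K \<subseteq> in_vars 3" "var_exp t \<in> in_vars 3"
        using JK by (auto simp: in_vars_def)
      show "b \<in> carrier (E i)" using C.killedD(1)[OF b] .
      show "Q.cls (monom s) \<odot>\<^bsub>E i\<^esub> b = \<zero>\<^bsub>E i\<^esub>" if s: "s \<in> var_exp ` K" for s
      proof -
        obtain j where "j \<in> K" "s = var_exp j" using s by blast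
        then show ?thesis using C.killedD(2)[OF b, of "v j"] by (simp add: v_def)
      qed
      show "m \<in> divisible_by (var_exp ` K)"
        if "m + var_exp t \<in> divisible_by (U \<union> var_exp ` J)" for m
        using JK that unfolding divisible divisible_by_vars_iff
        by (auto simp: lookup_add lookup_single when_def split: if_splits)
    qed
    then show ?thesis unfolding C.killed_def v_def by auto
  qed
  have lift_x: "\<exists>e \<in> carrier (E i). v 1 \<odot>\<^bsub>E i\<^esub> e = b"
    if "injective_resolution Q.R (regular_module Q.R) E e d" "b \<in> acyclic_module_complex.killed E {v 2, v 3} i"
    for E :: "nat \<Rightarrow> ('k mpoly set, 'm) module" and e d b i
    using lift[OF that(1), of b "{2, 3}" i 1 "{}"] that(2)
      acyclic_module_complex.killedD(1)[OF acyclic_module_complexI[OF Q.R.is_cring that(1)]] by auto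
  have lift_y: "\<exists>e \<in> acyclic_module_complex.killed E {v 1} i. v 2 \<odot>\<^bsub>E i\<^esub> e = b"
    if "injective_resolution Q.R (regular_module Q.R) E e d" "b \<in> acyclic_module_complex.killed E {v 1} i"
    for E :: "nat \<Rightarrow> ('k mpoly set, 'm) module" and e d b i
    using lift[OF that(1), of b "{1}" i 2 "{1}"] that(2) by auto
  have lift_z: "\<exists>e \<in> acyclic_module_complex.killed E {v 2} i. v 3 \<odot>\<^bsub>E i\<^esub> e = b"
    if "injective_resolution Q.R (regular_module Q.R) E e d" "b \<in> acyclic_module_complex.killed E {v 1, v 2} i"
    for E :: "nat \<Rightarrow> ('k mpoly set, 'm) module" and e d b i
    using lift[OF that(1), of b "{1, 2}" i 3 "{2}"] that(2) by auto
  have x: "{v 1} \<subseteq> carrier Q.R" using v by blast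
  show ?thesis unfolding R
  proof (rule injective_dimension_infinite[OF Q.R.is_cring x])
    fix E :: "nat \<Rightarrow> ('k mpoly set, 'm) module" and e d
    assume res: "injective_resolution Q.R (regular_module Q.R) E e d"
    interpret C: acyclic_module_complex Q.R E d by (rule acyclic_module_complexI[OF Q.R.is_cring res])
    note cocycle_0 = cocycle_0_iff[OF Q.R.is_cring res x]
    have e: "e (r \<otimes>\<^bsub>Q.R\<^esub> s \<oplus>\<^bsub>Q.R\<^esub> r' \<otimes>\<^bsub>Q.R\<^esub> s') = r \<odot>\<^bsub>E 0\<^esub> e s \<oplus>\<^bsub>E 0\<^esub> r' \<odot>\<^bsub>E 0\<^esub> e s'"
      if "r \<in> carrier Q.R" "s \<in> carrier Q.R" "r' \<in> carrier Q.R" "s' \<in> carrier Q.R" for r s r' s'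
      using res that by (simp add: injective_resolution_def module_hom_def regular_module_def)
    have inj: "inj_on e (carrier Q.R)"
      using res by (simp add: injective_resolution_def regular_module_def)
    have "C.ext_Suc_nonzero {v 1} (Suc (Suc 0))"
    proof (rule C.plane_line_ext_from_cocycle[OF v prod prod lift_x[OF res] lift_y[OF res] lift_z[OF res]])
      show "e (v 2) \<in> C.cocycle {v 1} 0" unfolding cocycle_0 using v prod by auto
      fix s' t' assume "s' \<in> C.cocycle {v 1} 0" "t' \<in> C.cocycle {v 1} 0"
      then obtain s t where s: "s \<in> carrier Q.R" "s' = e s" "v 1 \<otimes>\<^bsub>Q.R\<^esub> s = \<zero>\<^bsub>Q.R\<^esub>"
        and t: "t \<in> carrier Q.R" "t' = e t" unfolding cocycle_0 by auto
      obtain p where p: "p \<in> carrier Q.P" "s = Q.cls p" using Q.cls_surj[OF s(1)] .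
      obtain q where q: "q \<in> carrier Q.P" "t = Q.cls q" using Q.cls_surj[OF t(1)] .
      note pc = Q.P.m_closed[OF p(1) c] and qc = Q.P.m_closed[OF q(1) c]
      have cls_p: "Q.cls (p * monom (var_exp j)) = v j \<otimes>\<^bsub>Q.R\<^esub> s" if "j \<in> {1, 2, 3}" for j
        unfolding p(2) v_def using Q.cls_mult[OF p(1) c[OF that]] Q.R.m_comm p(1) c[OF that] by simp
      have cls_q: "Q.cls (q * monom (var_exp j)) = v j \<otimes>\<^bsub>Q.R\<^esub> t" if "j \<in> {1, 2, 3}" for j
        unfolding q(2) v_def using Q.cls_mult[OF q(1) c[OF that]] Q.R.m_comm q(1) c[OF that] by simp
      have lin: "var_exp j \<notin> divisible_by U" for j
        unfolding U_def by (rule var_exp_not_divisible_by_products) blast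
      show "v 2 \<odot>\<^bsub>E 0\<^esub> s' \<oplus>\<^bsub>E 0\<^esub> v 3 \<odot>\<^bsub>E 0\<^esub> t' \<noteq> e (v 2)"
      proof
        assume "v 2 \<odot>\<^bsub>E 0\<^esub> s' \<oplus>\<^bsub>E 0\<^esub> v 3 \<odot>\<^bsub>E 0\<^esub> t' = e (v 2)"
        then have "v 2 \<otimes>\<^bsub>Q.R\<^esub> s \<oplus>\<^bsub>Q.R\<^esub> v 3 \<otimes>\<^bsub>Q.R\<^esub> t = v 2"
          using e[OF v(2) s(1) v(3) t(1)] s t v inj_onD[OF inj] by simp
        then have "Q.cls (p * monom (var_exp 2) + q * monom (var_exp 3)) = Q.cls (monom (var_exp 2))"
          using Q.cls_add[OF pc[of 2] qc[of 3]] cls_p[of 2] cls_q[of 3] by (simp add: v_def)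
        then have 1: "p * monom (var_exp 2) + q * monom (var_exp 3) - monom (var_exp 2) \<in> Q.I"
          using Q.cls_eq_iff[OF Q.P.a_closed[OF pc[of 2] qc[of 3]] c[of 2]] by simp
        have 2: "p * monom (var_exp 1) \<in> Q.I"
          using Q.cls_eq_zero_iff[OF pc[of 1]] cls_p[of 1] s(3) by simp
        have "var_exp 2 \<notin> divisible_by {var_exp 3}"
          using divisible_by_vars_iff[of "var_exp 2" "{3}"] by (simp add: lookup_single)
        then have "Poly_Mapping.lookup p 0 = 1"
          using Q.lookup_eq_zero_if_in_I[OF 1 lin, of 2] lookup_mult_monom[of p "var_exp 2" 0]
            lookup_mult_monom_not_divisible[of "var_exp 2" "var_exp 3" q]
          by (simp add: lookup_minus lookup_add monom_def)
        moreover have "Poly_Mapping.lookup p 0 = 0"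
          using Q.lookup_eq_zero_if_in_I[OF 2 lin, of 1] lookup_mult_monom[of p "var_exp 1" 0] by simp
        ultimately show False by simp
      qed
    qed simp_all
    then show "\<exists>i. C.ext_Suc_nonzero {v 1} i" ..
    fix i assume "C.ext_Suc_nonzero {v 1} i"
    then have "C.ext_Suc_nonzero {v 1} (Suc (Suc (Suc i)))"
      by (intro C.plane_line_ext_step[OF v prod prod lift_x[OF res] lift_y[OF res] lift_z[OF res]]) simp_all
    then show "\<exists>j>i. C.ext_Suc_nonzero {v 1} j" by (intro exI[of _ "Suc (Suc (Suc i))"]) simp
  qed
qed

lemma injective_dimension_square_zero:
  fixes k :: "'k::field itself"
  defines "R \<equiv> mpoly_ring k 2 Quot (Idl\<^bsub>mpoly_ring k 2\<^esub>
    {(mpoly_var 1)\<^sup>2, mpoly_var 1 * mpoly_var 2, (mpoly_var 2)\<^sup>2})"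
  shows "injective_dimension TYPE('m) R (regular_module R) = \<infinity>"
proof -
  define U where "U = {var_exp 1 + var_exp 1, var_exp 1 + var_exp 2, var_exp 2 + var_exp 2}"
  interpret Q: monomial_quotient k 2 U
    by unfold_locales (auto simp: U_def in_vars_def keys_add_nat)
  have "{(mpoly_var 1)\<^sup>2, mpoly_var 1 * mpoly_var 2, (mpoly_var 2)\<^sup>2 :: 'k mpoly} = monom ` U"
    by (simp add: U_def mpoly_var_mult_eq power2_eq_square)
  then have R: "R = Q.R" unfolding R_def Q.R_def Q.I_def Q.P_def by simp
  show ?thesis unfolding R
  proof (rule Q.injective_dimension_infinite_if_variable_in_socle)
    fix j :: nat assume "j \<in> {1..2}"
    then have "j = 1 \<or> j = 2" by auto
    then show "var_exp j + var_exp 1 \<in> U" by (auto simp: U_def add.commute)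
    show "var_exp j \<notin> divisible_by U"
      unfolding U_def by (rule var_exp_not_divisible_by_products) auto
  qed simp
qed

lemma injective_dimension_axes_with_embedded_point:
  fixes k :: "'k::field itself"
  assumes "n \<ge> 2"
  defines "R \<equiv> mpoly_ring k n Quot (Idl\<^bsub>mpoly_ring k n\<^esub> ({(mpoly_var 1)\<^sup>2} \<union>
    {mpoly_var i * mpoly_var j | i j. i \<in> {1..n} \<and> j \<in> {1..n} \<and> i \<noteq> j}))"
  shows "injective_dimension TYPE('m) R (regular_module R) = \<infinity>"
proof -
  define U where "U = {var_exp 1 + var_exp 1} \<union>
    {var_exp i + var_exp j | i j. i \<in> {1..n} \<and> j \<in> {1..n} \<and> i \<noteq> j}"
  interpret Q: monomial_quotient k n U
    using assms(1) by unfold_locales (auto simp: U_def in_vars_def keys_add_nat)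
  have "{(mpoly_var 1)\<^sup>2} \<union> {mpoly_var i * mpoly_var j | i j. i \<in> {1..n} \<and> j \<in> {1..n} \<and> i \<noteq> j}
      = (monom ` U :: 'k mpoly set)"
    unfolding U_def mpoly_var_mult_eq power2_eq_square image_Un by blast
  then have R: "R = Q.R" unfolding R_def Q.R_def Q.I_def Q.P_def by simp
  show ?thesis unfolding R
  proof (rule Q.injective_dimension_infinite_if_variable_in_socle[OF assms(1)])
    fix j assume "j \<in> {1..n}"
    moreover have "1 \<in> {1..n}" using assms(1) by simp
    ultimately show "var_exp j + var_exp 1 \<in> U" unfolding U_def by (cases "j = 1") blast+
    show "var_exp j \<notin> divisible_by U"
      unfolding U_def by (rule var_exp_not_divisible_by_products) auto
  qed
qed

theorem theorem15:
  fixes k :: "'k::field itself"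
  shows
    "(let P = mpoly_ring k 3;
          R = P Quot (Idl\<^bsub>P\<^esub> {mpoly_var 1 * mpoly_var 2, mpoly_var 1 * mpoly_var 3})
      in injective_dimension TYPE('m) R (regular_module R) = \<infinity>) \<and>
     (let P = mpoly_ring k 2;
          R = P Quot (Idl\<^bsub>P\<^esub> {(mpoly_var 1)\<^sup>2, mpoly_var 1 * mpoly_var 2, (mpoly_var 2)\<^sup>2})
      in injective_dimension TYPE('m) R (regular_module R) = \<infinity>) \<and>
     (\<forall>n\<ge>2. let P = mpoly_ring k n;
          R = P Quot (Idl\<^bsub>P\<^esub>
            ({(mpoly_var 1)\<^sup>2} \<union> {mpoly_var i * mpoly_var j | i j. i \<in> {1..n} \<and> j \<in> {1..n} \<and> i \<noteq> j}))
      in injective_dimension TYPE('m) R (regular_module R) = \<infinity>)"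
  unfolding Let_def
  by (intro conjI allI impI injective_dimension_plane_line injective_dimension_square_zero
      injective_dimension_axes_with_embedded_point)

end
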